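(* Let $k\geq 2$ and let $n$ be sufficiently large (with respect to $k$). If $G$ is a $\Gamma_k$-free graph of order $n$ that attains the maximum spectral radius among all $\Gamma_k$-free graphs of order $n$, then $G\in \mathrm{EX}(n,\Gamma_k)$. More precisely, $G$ is obtained from the complete bipartite graph $K_{\lfloor n/2\rfloor,\lceil n/2\rceil}$ by embedding a graph $H$ with $k-1$ edges in the $\lfloor n/2\rfloor$-vertex partition set, where $H\cong C_3$ if $k=4$ and $H\cong K_{1,k-1}$ otherwise.
   Context: All graphs are finite, simple and undirected. The order of a graph is its number of vertices. The spectral radius of a graph is the largest eigenvalue of its adjacency matrix. $\Gamma_k$ is the family of graphs containing $k$ pairwise edge-disjoint triangles. A graph is $\Gamma_k$-free if it contains no graph in $\Gamma_k$ as a subgraph, i.e. if it does not contain $k$ pairwise edge-disjoint triangles. $\mathrm{ex}(n,\Gamma_k)$ is the maximum number of edges in a $\Gamma_k$-free graph of order $n$, and $\mathrm{EX}(n,\Gamma_k)$ is the family of $\Gamma_k$-free graphs of order $n$ with exactly $\mathrm{ex}(n,\Gamma_k)$ edges. $K_{a,b}$ is the complete bipartite graph with parts of sizes $a$ and $b$, and $C_3$ is the triangle. Embedding a graph $H$ in a partition set of a complete bipartite graph means adding the edges of one copy of $H$ whose vertices all lie in that partition set, the remaining vertices of the set receiving no new edges. *)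

theory Defs
  imports "Jordan_Normal_Form.Char_Poly"
begin

type_synonym 'a graph = "'a set \<times> 'a set set"

abbreviation verts :: "'a graph \<Rightarrow> 'a set" where "verts \<equiv> fst"
abbreviation edges :: "'a graph \<Rightarrow> 'a set set" where "edges \<equiv> snd"

definition simple_graph :: "'a graph \<Rightarrow> bool" where
  "simple_graph G \<longleftrightarrow> finite (verts G) \<and> (\<forall>e\<in>edges G. e \<subseteq> verts G \<and> card e = 2)"

text \<open>The rows and columns are indexed by the vertices in increasing order; the eigenvalues do
  not depend on the chosen enumeration.\<close>

definition adjacency_matrix :: "'a::linorder graph \<Rightarrow> real mat" where
  "adjacency_matrix G =
     (let vs = sorted_list_of_set (verts G); n = card (verts G)
      in mat n n (\<lambda>(i, j). if {vs ! i, vs ! j} \<in> edges G then 1 else 0))"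

text \<open>The set of eigenvalues is finite, and nonempty for a simple graph with at least one vertex;
  for the graph without vertices the value is unspecified.\<close>

definition graph_spectral_radius :: "'a::linorder graph \<Rightarrow> real" where
  "graph_spectral_radius G = Max {l. eigenvalue (adjacency_matrix G) l}"

definition graph_iso :: "'a graph \<Rightarrow> 'b graph \<Rightarrow> bool" where
  "graph_iso G H \<longleftrightarrow> (\<exists>f. bij_betw f (verts G) (verts H) \<and>
     (\<forall>u\<in>verts G. \<forall>v\<in>verts G. {u, v} \<in> edges G \<longleftrightarrow> {f u, f v} \<in> edges H))"

text \<open>Subgraphs are taken up to isomorphism and need not be induced.\<close>

definition contains_subgraph :: "'a graph \<Rightarrow> 'b graph \<Rightarrow> bool" where
  "contains_subgraph G H \<longleftrightarrow> (\<exists>f. inj_on f (verts H) \<and> f ` verts H \<subseteq> verts G \<and>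
     (\<forall>e\<in>edges H. f ` e \<in> edges G))"

text \<open>A triangle is represented by its set of three edges.\<close>

definition triangles :: "'a graph \<Rightarrow> 'a set set set" where
  "triangles G = {T. T \<subseteq> edges G \<and>
     (\<exists>a b c. a \<noteq> b \<and> b \<noteq> c \<and> a \<noteq> c \<and> T = {{a, b}, {b, c}, {a, c}})}"

definition Gamma :: "nat \<Rightarrow> 'a graph set" where
  "Gamma k = {G. simple_graph G \<and>
     (\<exists>S. S \<subseteq> triangles G \<and> finite S \<and> card S = k \<and> pairwise disjnt S)}"

definition free_graphs :: "nat \<Rightarrow> 'a graph set \<Rightarrow> 'a graph set" where
  "free_graphs n F = {G. simple_graph G \<and> card (verts G) = n \<and>
     (\<forall>H\<in>F. \<not> contains_subgraph G H)}"

definition ex_number :: "nat \<Rightarrow> 'a graph set \<Rightarrow> nat" where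
  "ex_number n F = Max ((\<lambda>G. card (edges G)) ` free_graphs n F)"

definition EX_graphs :: "nat \<Rightarrow> 'a graph set \<Rightarrow> 'a graph set" where
  "EX_graphs n F = {G \<in> free_graphs n F. card (edges G) = ex_number n F}"

text \<open>Meant for disjoint \<open>A\<close> and \<open>B\<close>.\<close>

definition complete_bipartite :: "'a set \<Rightarrow> 'a set \<Rightarrow> 'a graph" where
  "complete_bipartite A B = (A \<union> B, {{a, b} | a b. a \<in> A \<and> b \<in> B})"

definition K_bip :: "nat \<Rightarrow> nat \<Rightarrow> nat graph" where
  "K_bip a b = complete_bipartite {..<a} {a..<a + b}"

definition C3 :: "nat graph" where
  "C3 = ({0, 1, 2}, {{0, 1}, {1, 2}, {0, 2}})"

text \<open>\<open>G\<close> arises from the complete bipartite graph with parts of sizes \<open>a\<close> and \<open>b\<close> by embedding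
  \<open>H\<close> in the part of size \<open>a\<close>; here \<open>H\<close> is the embedded copy itself.\<close>

definition bipartite_with_embedded :: "nat \<Rightarrow> nat \<Rightarrow> 'a graph \<Rightarrow> 'a graph \<Rightarrow> bool" where
  "bipartite_with_embedded a b H G \<longleftrightarrow>
     (\<exists>A B. finite A \<and> finite B \<and> A \<inter> B = {} \<and> card A = a \<and> card B = b \<and> verts H \<subseteq> A \<and>
        G = (A \<union> B, edges (complete_bipartite A B) \<union> edges H))"

end

theory Submission
  imports Defs "Jordan_Normal_Form.Spectral_Radius" "HOL-Analysis.Convex"
begin

text \<open>Deleting the edges of a maximal packing of at most \<open>m = k - 1\<close> edge-disjoint triangles makes a
  \<open>\<Gamma>\<^sub>k\<close>-free graph triangle-free, at the price of only \<open>3m\<close> edges. As the triangle-free part with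
  \<open>e\<close> edges has spectral radius at most \<open>sqrt e\<close> (weighted Mantel inequality) and the deleted edges
  contribute \<open>O(1/n)\<close> to the quadratic form, a graph with spectral radius at least
  \<open>sqrt (floor (n\<^sup>2/4))\<close> has at least \<open>n\<^sup>2/4 - O(m)\<close> edges. A triangle-free graph that dense contains an edge
  \<open>uv\<close> with \<open>d(u) + d(v) \<ge> n\<close>, hence is bipartite with parts \<open>N(u)\<close> and \<open>N(v)\<close> and misses only \<open>O(m)\<close>
  cross edges. A greedy choice of apexes then shows that at most \<open>m\<close> edges lie inside the parts.

  For such a graph with parts \<open>A\<close>, \<open>B\<close>, counting walks of length at most three inside the parts
  gives, up to \<open>O(1/n\<^sup>2)\<close>, \<open>l\<^sup>2 \<le> e(A,B) + (|B| w(A) + |A| w(B)) / l\<close>, where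
  \<open>w(X) = w\<^sub>1(X) + w\<^sub>2(X)/l + w\<^sub>3(X)/l\<^sup>2\<close> counts the walks of inner edges in \<open>X\<close>. This is compared with
  an eigenvalue \<open>l\<close> of the claimed optimum. The constant terms force a complete balanced bipartite graph with
  exactly \<open>m\<close> inner edges; the terms of order \<open>1/n\<close> force \<open>w\<^sub>2\<close>, the sum of the squared degrees, to be
  maximal, so that the inner edges pairwise meet (a star or a triangle), and the opposite part to be the
  larger one; for \<open>m = 3\<close> the triangle wins through \<open>w\<^sub>3 = 24 > 18\<close>.\<close>

subsection \<open>Eigenvalues of the adjacency matrix\<close>

text \<open>Indexing by vertices rather than by matrix positions keeps the enumeration of the vertex
  set out of the combinatorial arguments.\<close>

definition adj :: "'a set set \<Rightarrow> 'a \<Rightarrow> 'a \<Rightarrow> real" where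
  "adj E u v = (if {u, v} \<in> E then 1 else 0)"

lemma adj_commute: "adj E u v = adj E v u"
  by (simp add: adj_def insert_commute)

lemma adj_nonneg [simp]: "0 \<le> adj E u v"
  by (simp add: adj_def)

lemma adj_le_1 [simp]: "adj E u v \<le> 1"
  by (simp add: adj_def)

definition is_eigvec :: "'a graph \<Rightarrow> real \<Rightarrow> ('a \<Rightarrow> real) \<Rightarrow> bool" where
  "is_eigvec G l x \<longleftrightarrow> (\<exists>v\<in>verts G. x v \<noteq> 0) \<and>
     (\<forall>u\<in>verts G. (\<Sum>v\<in>verts G. adj (edges G) u v * x v) = l * x u)"

lemma adjacency_matrix_carrier:
  "adjacency_matrix G \<in> carrier_mat (card (verts G)) (card (verts G))"
  by (simp add: adjacency_matrix_def Let_def)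

lemma nth_sorted_bij:
  assumes "finite V"
  shows "bij_betw (\<lambda>i. sorted_list_of_set V ! i) {..<card V} V"
  using bij_betw_nth[of "sorted_list_of_set V" "{..<card V}" V] assms
  by (simp add: distinct_card)

lemma adjacency_matrix_mult_vec:
  fixes G :: "'a::linorder graph" and v :: "real vec"
  assumes "finite (verts G)" and v: "v \<in> carrier_vec (card (verts G))"
    and x: "\<And>i. i < card (verts G) \<Longrightarrow> x (sorted_list_of_set (verts G) ! i) = v $ i"
    and i: "i < card (verts G)"
  shows "(adjacency_matrix G *\<^sub>v v) $ i =
    (\<Sum>w\<in>verts G. adj (edges G) (sorted_list_of_set (verts G) ! i) w * x w)"
proof -
  let ?vs = "sorted_list_of_set (verts G)"
  have "(adjacency_matrix G *\<^sub>v v) $ i = (\<Sum>j<card (verts G). adj (edges G) (?vs ! i) (?vs ! j) * v $ j)"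
    using i v by (simp add: adjacency_matrix_def Let_def scalar_prod_def adj_def lessThan_atLeast0)
  also have "\<dots> = (\<Sum>j<card (verts G). adj (edges G) (?vs ! i) (?vs ! j) * x (?vs ! j))"
    using x by (intro sum.cong) auto
  also have "\<dots> = (\<Sum>w\<in>verts G. adj (edges G) (?vs ! i) w * x w)"
    by (rule sum.reindex_bij_betw[OF nth_sorted_bij[OF assms(1)]])
  finally show ?thesis .
qed

text \<open>The enumeration of the vertices carries vectors to functions on \<open>verts G\<close>
  and back, so that later arguments can use functions instead of matrices.\<close>

lemma eigenvalue_adjacency_iff:
  fixes G :: "'a::linorder graph"
  assumes fin: "finite (verts G)"
  shows "eigenvalue (adjacency_matrix G) l \<longleftrightarrow> (\<exists>x. is_eigvec G l x)"
proof
  let ?n = "card (verts G)" and ?vs = "sorted_list_of_set (verts G)"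
  note bij = nth_sorted_bij[OF fin]
  {
    assume "eigenvalue (adjacency_matrix G) l"
    then obtain v where v: "v \<in> carrier_vec ?n" "v \<noteq> 0\<^sub>v ?n"
        "adjacency_matrix G *\<^sub>v v = l \<cdot>\<^sub>v v"
      unfolding eigenvalue_def eigenvector_def using adjacency_matrix_carrier[of G] by auto
    define x where "x w = v $ (the_inv_into {..<?n} (\<lambda>i. ?vs ! i) w)" for w
    have x: "x (?vs ! i) = v $ i" if "i < ?n" for i
      using the_inv_into_f_f[OF bij_betw_imp_inj_on[OF bij], of i] that by (simp add: x_def)
    obtain i where i: "i < ?n" "v $ i \<noteq> 0"
      using v by (metis eq_vecI carrier_vecD index_zero_vec(1) index_zero_vec(2))
    have "\<exists>w\<in>verts G. x w \<noteq> 0"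
      using i x[of i] bij_betwE[OF bij] by (intro bexI[of _ "?vs ! i"]) auto
    moreover have "(\<Sum>w\<in>verts G. adj (edges G) u w * x w) = l * x u" if "u \<in> verts G" for u
    proof -
      have "u \<in> (\<lambda>i. ?vs ! i) ` {..<?n}"
        using that bij by (simp add: bij_betw_def)
      then obtain j where j: "j < ?n" "u = ?vs ! j" by blast
      show ?thesis
        using adjacency_matrix_mult_vec[OF fin v(1) x j(1)] v(1,3) j x[OF j(1)] by simp
    qed
    ultimately show "\<exists>x. is_eigvec G l x" unfolding is_eigvec_def by blast
  }
  {
    assume "\<exists>x. is_eigvec G l x"
    then obtain x where x: "\<exists>v\<in>verts G. x v \<noteq> 0"
        "\<And>u. u \<in> verts G \<Longrightarrow> (\<Sum>v\<in>verts G. adj (edges G) u v * x v) = l * x u"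
      unfolding is_eigvec_def by blast
    define v where "v = vec ?n (\<lambda>i. x (?vs ! i))"
    have v: "v \<in> carrier_vec ?n" by (simp add: v_def)
    obtain w where w: "w \<in> verts G" "x w \<noteq> 0" using x by blast
    then obtain j where j: "j < ?n" "w = ?vs ! j" using bij unfolding bij_betw_def by auto
    have "v $ j \<noteq> 0" using j w by (simp add: v_def)
    hence "v \<noteq> 0\<^sub>v ?n" using j by auto
    moreover have "adjacency_matrix G *\<^sub>v v = l \<cdot>\<^sub>v v"
    proof (rule eq_vecI)
      show "dim_vec (adjacency_matrix G *\<^sub>v v) = dim_vec (l \<cdot>\<^sub>v v)"
        using adjacency_matrix_carrier[of G] v by auto
      fix i assume "i < dim_vec (l \<cdot>\<^sub>v v)"
      hence i: "i < ?n" using v by auto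
      have "?vs ! i \<in> verts G" using bij_betwE[OF bij] i by blast
      from x(2)[OF this] show "(adjacency_matrix G *\<^sub>v v) $ i = (l \<cdot>\<^sub>v v) $ i"
        using adjacency_matrix_mult_vec[OF fin v _ i, of x] i by (simp add: v_def)
    qed
    ultimately show "eigenvalue (adjacency_matrix G) l"
      unfolding eigenvalue_def eigenvector_def using v adjacency_matrix_carrier[of G] by auto
  }
qed

lemma finite_eigenvalues_adjacency: "finite {l. eigenvalue (adjacency_matrix G) l}"
  using card_finite_spectrum(1)[OF adjacency_matrix_carrier[of G]] by (simp add: spectrum_def)

text \<open>The complexified adjacency matrix has an eigenvalue \<open>c\<close>. Symmetry makes
  \<open>c\<close> real, so the real and the imaginary part of an eigenvector both satisfy the
  eigenvalue equation, and one of them is nonzero. This ensures that the \<open>Max\<close> in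
  \<open>graph_spectral_radius\<close> is attained.\<close>

lemma eigenvalue_adjacency_exists:
  fixes G :: "'a::linorder graph"
  assumes fin: "finite (verts G)" and ne: "verts G \<noteq> {}"
  shows "\<exists>l. eigenvalue (adjacency_matrix G) l"
proof -
  let ?n = "card (verts G)" and ?vs = "sorted_list_of_set (verts G)"
  note bij = nth_sorted_bij[OF fin]
  define A where "A = map_mat complex_of_real (adjacency_matrix G)"
  have A: "A \<in> carrier_mat ?n ?n" using adjacency_matrix_carrier[of G] by (simp add: A_def)
  have "?n > 0" using assms by (simp add: card_gt_0_iff)
  from spectrum_non_empty[OF A this] obtain c where "eigenvalue A c" by (auto simp: spectrum_def)
  then obtain v where v: "v \<in> carrier_vec ?n" "v \<noteq> 0\<^sub>v ?n" "A *\<^sub>v v = c \<cdot>\<^sub>v v"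
    unfolding eigenvalue_def eigenvector_def using A by auto
  define a where "a i j = adjacency_matrix G $$ (i, j)" for i j
  have sym: "a i j = a j i" if "i < ?n" "j < ?n" for i j
    using that by (simp add: a_def adjacency_matrix_def Let_def insert_commute)
  have row: "(\<Sum>j<?n. of_real (a i j) * v $ j) = c * v $ i" if i: "i < ?n" for i
  proof -
    have "(A *\<^sub>v v) $ i = (\<Sum>j<?n. of_real (a i j) * v $ j)"
      using i v(1) A adjacency_matrix_carrier[of G]
      by (simp add: A_def a_def scalar_prod_def lessThan_atLeast0)
    thus ?thesis using v i by simp
  qed
  \<comment> \<open>The Hermitian form of a symmetric real matrix takes real values, hence so does the eigenvalue.\<close>
  define Q where "Q = (\<Sum>i<?n. cnj (v $ i) * (\<Sum>j<?n. of_real (a i j) * v $ j))"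
  have "cnj Q = (\<Sum>i<?n. \<Sum>j<?n. of_real (a i j) * v $ i * cnj (v $ j))"
    by (simp add: Q_def sum_distrib_left mult_ac)
  also have "\<dots> = (\<Sum>j<?n. \<Sum>i<?n. of_real (a j i) * v $ i * cnj (v $ j))"
    by (subst sum.swap, intro sum.cong refl) (use sym in auto)
  also have "\<dots> = Q" by (simp add: Q_def sum_distrib_left mult_ac)
  finally have Qreal: "cnj Q = Q" .
  define r where "r = (\<Sum>i<?n. (cmod (v $ i))\<^sup>2)"
  obtain i0 where i0: "i0 < ?n" "v $ i0 \<noteq> 0"
    using v by (metis eq_vecI carrier_vecD index_zero_vec(1) index_zero_vec(2))
  have "r > 0" unfolding r_def using i0 by (intro sum_pos2[of _ i0]) auto
  have "Q = (\<Sum>i<?n. c * of_real ((cmod (v $ i))\<^sup>2))"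
    unfolding Q_def
  proof (intro sum.cong refl)
    fix i assume "i \<in> {..<?n}"
    hence "cnj (v $ i) * (\<Sum>j<?n. of_real (a i j) * v $ j) = c * (v $ i * cnj (v $ i))"
      using row[of i] by simp
    thus "cnj (v $ i) * (\<Sum>j<?n. of_real (a i j) * v $ j) = c * of_real ((cmod (v $ i))\<^sup>2)"
      by (simp only: complex_norm_square)
  qed
  also have "\<dots> = c * of_real r" by (simp add: r_def sum_distrib_left)
  finally have "cnj c = c" using Qreal \<open>r > 0\<close> by simp
  hence c: "c = of_real (Re c)" by (simp add: complex_eq_iff)
  define x where "x g w = g (v $ (the_inv_into {..<?n} (\<lambda>i. ?vs ! i) w))" for g :: "complex \<Rightarrow> real" and w
  have x: "x g (?vs ! i) = g (v $ i)" if "i < ?n" for i g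
    using the_inv_into_f_f[OF bij_betw_imp_inj_on[OF bij], of i] that by (simp add: x_def)
  have eq: "(\<Sum>w\<in>verts G. adj (edges G) u w * x g w) = Re c * x g u"
    if u: "u \<in> verts G" and g: "g = Re \<or> g = Im" for u g
  proof -
    obtain j where j: "j < ?n" "u = ?vs ! j" using bij u unfolding bij_betw_def by auto
    have "(\<Sum>w\<in>verts G. adj (edges G) u w * x g w)
        = (\<Sum>i<?n. adj (edges G) u (?vs ! i) * x g (?vs ! i))"
      by (rule sum.reindex_bij_betw[OF bij, symmetric])
    also have "\<dots> = (\<Sum>i<?n. a j i * g (v $ i))"
      using j by (intro sum.cong refl) (auto simp: x a_def adj_def adjacency_matrix_def Let_def)
    also have "\<dots> = g (\<Sum>i<?n. of_real (a j i) * v $ i)" using g by auto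
    also have "\<dots> = g (of_real (Re c) * v $ j)" using row[OF j(1)] c by simp
    also have "\<dots> = Re c * x g u" using g j x by auto
    finally show ?thesis .
  qed
  have "Re (v $ i0) \<noteq> 0 \<or> Im (v $ i0) \<noteq> 0" using i0 by (auto simp: complex_eq_iff)
  then obtain g where g: "g = Re \<or> g = Im" "g (v $ i0) \<noteq> 0" by blast
  have "?vs ! i0 \<in> verts G" using bij_betwE[OF bij] i0 by blast
  hence "is_eigvec G (Re c) (x g)"
    unfolding is_eigvec_def using eq g x[OF i0(1), of g] by force
  thus ?thesis using eigenvalue_adjacency_iff[OF fin] by blast
qed

lemma spectral_radius_ge:
  fixes G :: "'a::linorder graph"
  assumes "finite (verts G)" "is_eigvec G l x"
  shows "l \<le> graph_spectral_radius G"
  unfolding graph_spectral_radius_def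
  using assms eigenvalue_adjacency_iff finite_eigenvalues_adjacency[of G] by (intro Max_ge) blast+

text \<open>Taking absolute values of an eigenvector avoids the Perron--Frobenius theorem.\<close>

lemma spectral_radius_subinvariant:
  fixes G :: "'a::linorder graph"
  assumes fin: "finite (verts G)" and ne: "verts G \<noteq> {}" and l: "0 \<le> l" "l \<le> graph_spectral_radius G"
  obtains y where "\<And>v. 0 \<le> y v" "\<exists>v\<in>verts G. y v \<noteq> 0"
    "\<And>u. u \<in> verts G \<Longrightarrow> l * y u \<le> (\<Sum>v\<in>verts G. adj (edges G) u v * y v)"
proof -
  let ?r = "graph_spectral_radius G"
  have "?r \<in> {l. eigenvalue (adjacency_matrix G) l}"
    unfolding graph_spectral_radius_def
    using eigenvalue_adjacency_exists[OF fin ne] finite_eigenvalues_adjacency[of G]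
    by (intro Max_in) blast+
  then obtain x where x: "is_eigvec G ?r x" using eigenvalue_adjacency_iff[OF fin] by blast
  have "l * \<bar>x u\<bar> \<le> (\<Sum>v\<in>verts G. adj (edges G) u v * \<bar>x v\<bar>)" if u: "u \<in> verts G" for u
  proof -
    have "l * \<bar>x u\<bar> \<le> ?r * \<bar>x u\<bar>" using l by (intro mult_right_mono) auto
    also have "\<dots> = \<bar>?r * x u\<bar>" using l by (simp add: abs_mult)
    also have "\<dots> = \<bar>\<Sum>v\<in>verts G. adj (edges G) u v * x v\<bar>"
      using x u by (simp add: is_eigvec_def)
    also have "\<dots> \<le> (\<Sum>v\<in>verts G. \<bar>adj (edges G) u v * x v\<bar>)" by (rule sum_abs)
    finally show ?thesis by (simp add: abs_mult)
  qed
  with x show ?thesis by (intro that[of "\<lambda>v. \<bar>x v\<bar>"]) (auto simp: is_eigvec_def)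
qed

subsection \<open>Triangle-free graphs\<close>

lemma sum_adj: "finite V \<Longrightarrow> (\<Sum>v\<in>V. adj E u v) = real (card {v\<in>V. {u, v} \<in> E})"
  by (simp add: adj_def sum.If_cases Int_def)

lemma simple_graphD:
  assumes "simple_graph (V, E)"
  shows "finite V" "finite E" "\<And>e. e \<in> E \<Longrightarrow> e \<subseteq> V" "\<And>e. e \<in> E \<Longrightarrow> card e = 2"
    "\<And>u v. {u, v} \<in> E \<Longrightarrow> u \<in> V \<and> v \<in> V \<and> u \<noteq> v"
proof -
  show *: "finite V" "\<And>e. e \<in> E \<Longrightarrow> e \<subseteq> V" "\<And>e. e \<in> E \<Longrightarrow> card e = 2"
    using assms by (auto simp: simple_graph_def)
  thus "finite E" by (meson Pow_iff finite_Pow_iff finite_subset subsetI)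
  show "u \<in> V \<and> v \<in> V \<and> u \<noteq> v" if "{u, v} \<in> E" for u v
    using *(2)[OF that] *(3)[OF that] by (auto simp: card_insert_if split: if_splits)
qed

lemma degree_eq_incident_edges:
  assumes "simple_graph (V, E)"
  shows "(\<Sum>v\<in>V. adj E u v) = real (card {e\<in>E. u \<in> e})"
proof -
  note S = simple_graphD[OF assms]
  have "bij_betw (\<lambda>v. {u, v}) {v\<in>V. {u, v} \<in> E} {e\<in>E. u \<in> e}"
  proof (rule bij_betwI')
    fix e assume e: "e \<in> {e\<in>E. u \<in> e}"
    hence "card e = 2" using S(4) by blast
    then obtain x y where "e = {x, y}" by (auto simp: card_2_iff)
    thus "\<exists>v\<in>{v\<in>V. {u, v} \<in> E}. e = {u, v}"
      using e S(3)[of e] by (auto simp: insert_commute)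
  qed (auto simp: doubleton_eq_iff)
  from bij_betw_same_card[OF this] show ?thesis using sum_adj[OF S(1)] by metis
qed

lemma handshake:
  assumes "simple_graph (V, E)"
  shows "(\<Sum>u\<in>V. \<Sum>v\<in>V. adj E u v) = 2 * real (card E)"
proof -
  note S = simple_graphD[OF assms]
  have "(\<Sum>u\<in>V. \<Sum>v\<in>V. adj E u v) = (\<Sum>u\<in>V. \<Sum>e\<in>E. if u \<in> e then 1 else 0)"
    using S(2) by (intro sum.cong refl) (simp add: degree_eq_incident_edges[OF assms] sum.If_cases Int_def)
  also have "\<dots> = (\<Sum>e\<in>E. \<Sum>u\<in>V. if u \<in> e then 1 else 0)" by (rule sum.swap)
  also have "\<dots> = (\<Sum>e\<in>E. 2)"
  proof (rule sum.cong[OF refl])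
    fix e assume "e \<in> E"
    hence "V \<inter> {u. u \<in> e} = e" "card e = 2" using S by auto
    thus "(\<Sum>u\<in>V. if u \<in> e then 1 else 0) = (2::real)" using S(1) by (simp add: sum.If_cases)
  qed
  finally show ?thesis by simp
qed

definition triangle_free :: "'a set set \<Rightarrow> bool" where
  "triangle_free E \<longleftrightarrow> (\<forall>u v w. {u, v} \<in> E \<longrightarrow> {v, w} \<in> E \<longrightarrow> {u, w} \<in> E \<longrightarrow> False)"

lemma triangle_free_adj:
  assumes "triangle_free E" "{u, v} \<in> E"
  shows "adj E u w + adj E v w \<le> 1"
  using assms by (auto simp: triangle_free_def adj_def)

text \<open>This is the Motzkin-Straus bound for triangle-free graphs. The ends of an edge have
  disjoint neighbourhoods, so \<open>p u + p v \<le> Z\<close>. Summing over the edges with weights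
  \<open>z u * z v\<close> gives \<open>2 * Q \<le> T * Z\<close>, and Cauchy-Schwarz gives
  \<open>T^2 \<le> Z * Q\<close>.\<close>

lemma weighted_mantel:
  fixes z :: "'a \<Rightarrow> real"
  assumes "finite V" and tf: "triangle_free E" and z: "\<And>v. v \<in> V \<Longrightarrow> 0 \<le> z v"
  shows "2 * (\<Sum>u\<in>V. \<Sum>v\<in>V. adj E u v * z u * z v) \<le> (\<Sum>v\<in>V. z v)\<^sup>2"
proof -
  define p where "p u = (\<Sum>w\<in>V. adj E u w * z w)" for u
  define Z where "Z = (\<Sum>v\<in>V. z v)"
  define T where "T = (\<Sum>u\<in>V. \<Sum>v\<in>V. adj E u v * z u * z v)"
  define Q where "Q = (\<Sum>u\<in>V. z u * (p u)\<^sup>2)"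
  have Z0: "0 \<le> Z" using z by (auto simp: Z_def intro: sum_nonneg)
  have T0: "0 \<le> T" using z by (auto simp: T_def intro!: sum_nonneg mult_nonneg_nonneg)
  have Tp: "T = (\<Sum>u\<in>V. z u * p u)"
    by (simp add: T_def p_def sum_distrib_left mult_ac)
  have pp: "p u + p v \<le> Z" if "{u, v} \<in> E" for u v
  proof -
    have "p u + p v = (\<Sum>w\<in>V. (adj E u w + adj E v w) * z w)"
      by (simp add: p_def sum.distrib distrib_right)
    also have "\<dots> \<le> (\<Sum>w\<in>V. 1 * z w)"
      using z triangle_free_adj[OF tf that] by (intro sum_mono mult_right_mono) auto
    finally show ?thesis by (simp add: Z_def)
  qed
  have e1: "(\<Sum>u\<in>V. \<Sum>v\<in>V. adj E u v * z u * z v * p u) = Q"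
    by (simp add: Q_def p_def power2_eq_square sum_distrib_left sum_distrib_right mult_ac)
  have e2: "(\<Sum>u\<in>V. \<Sum>v\<in>V. adj E u v * z u * z v * p v) = Q"
    unfolding e1[symmetric] by (subst sum.swap) (simp add: adj_commute mult_ac)
  have "2 * Q = (\<Sum>u\<in>V. \<Sum>v\<in>V. adj E u v * z u * z v * (p u + p v))"
    using e1 e2 by (simp add: distrib_left sum.distrib)
  also have "\<dots> \<le> (\<Sum>u\<in>V. \<Sum>v\<in>V. adj E u v * z u * z v * Z)"
    using z by (intro sum_mono) (auto simp: adj_def intro!: mult_left_mono pp)
  also have "\<dots> = T * Z" by (simp add: T_def sum_distrib_right)
  finally have 1: "2 * Q \<le> T * Z" .
  \<comment> \<open>The split of \<open>z u\<close> into two square roots makes \<open>Z\<close> and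
    \<open>Q\<close> the two factors of Cauchy-Schwarz.\<close>
  have "T\<^sup>2 = (\<Sum>u\<in>V. sqrt (z u) * (sqrt (z u) * p u))\<^sup>2"
    unfolding Tp using z by (simp add: mult.assoc[symmetric])
  also have "\<dots> \<le> (\<Sum>u\<in>V. (sqrt (z u))\<^sup>2) * (\<Sum>u\<in>V. (sqrt (z u) * p u)\<^sup>2)"
    by (rule Cauchy_Schwarz_ineq_sum)
  also have "\<dots> = Z * Q" using z by (simp add: Z_def Q_def power_mult_distrib)
  finally have "2 * T\<^sup>2 \<le> Z * (2 * Q)" by simp
  also have "\<dots> \<le> Z * (T * Z)" using 1 Z0 by (rule mult_left_mono)
  finally have "T * (2 * T) \<le> T * Z\<^sup>2" by (simp add: power2_eq_square mult_ac)
  hence "2 * T \<le> Z\<^sup>2" using T0 by (cases "T = 0") (auto simp: mult_le_cancel_left)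
  thus ?thesis by (simp add: T_def Z_def)
qed

text \<open>Nosal's inequality. Cauchy-Schwarz over ordered pairs of vertices separates the number
  \<open>2 * card E\<close> of adjacent pairs from a form in the squares \<open>(y v)^2\<close>, to
  which \<open>weighted_mantel\<close> applies.\<close>

lemma triangle_free_quadratic_form:
  fixes y :: "'a \<Rightarrow> real"
  assumes sg: "simple_graph (V, E)" and tf: "triangle_free E" and y: "\<And>v. v \<in> V \<Longrightarrow> 0 \<le> y v"
  shows "(\<Sum>u\<in>V. \<Sum>v\<in>V. adj E u v * y u * y v) \<le> sqrt (card E) * (\<Sum>v\<in>V. (y v)\<^sup>2)"
proof -
  note S = simple_graphD[OF sg]
  have adj2: "adj E u v * adj E u v = adj E u v" for u v by (simp add: adj_def)
  have adj3: "(adj E u v)\<^sup>2 = adj E u v" for u v by (simp add: adj_def)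
  let ?T = "\<Sum>u\<in>V. \<Sum>v\<in>V. adj E u v * (y u)\<^sup>2 * (y v)\<^sup>2"
  \<comment> \<open>Entries are 0 or 1, so the factor \<open>adj E u v\<close> may be doubled; the
    first factor of Cauchy-Schwarz then counts adjacent pairs only.\<close>
  have "(\<Sum>u\<in>V. \<Sum>v\<in>V. adj E u v * y u * y v)\<^sup>2
      = (\<Sum>(u, v)\<in>V \<times> V. adj E u v * (adj E u v * y u * y v))\<^sup>2"
    by (simp add: sum.cartesian_product mult.assoc[symmetric] adj2)
  also have "\<dots> = (\<Sum>p\<in>V \<times> V. adj E (fst p) (snd p) * (adj E (fst p) (snd p) * y (fst p) * y (snd p)))\<^sup>2"
    by (simp add: case_prod_beta)
  also have "\<dots> \<le> (\<Sum>p\<in>V \<times> V. (adj E (fst p) (snd p))\<^sup>2) *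
      (\<Sum>p\<in>V \<times> V. (adj E (fst p) (snd p) * y (fst p) * y (snd p))\<^sup>2)"
    by (rule Cauchy_Schwarz_ineq_sum)
  also have "\<dots> = (\<Sum>u\<in>V. \<Sum>v\<in>V. adj E u v) * ?T"
    by (simp add: sum.cartesian_product case_prod_beta power_mult_distrib adj3)
  also have "\<dots> = real (card E) * (2 * ?T)" by (simp add: handshake[OF sg])
  also have "\<dots> \<le> real (card E) * (\<Sum>v\<in>V. (y v)\<^sup>2)\<^sup>2"
    by (intro mult_left_mono weighted_mantel[OF S(1) tf]) auto
  also have "\<dots> = (sqrt (card E) * (\<Sum>v\<in>V. (y v)\<^sup>2))\<^sup>2"
    by (simp add: power_mult_distrib)
  finally show ?thesis by (rule power2_le_imp_le) (auto intro!: mult_nonneg_nonneg sum_nonneg)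
qed

text \<open>If every edge had degree sum below \<open>n\<close>, summing over the edges and
  Cauchy-Schwarz would bound the number of edges by \<open>n * (n - 1) / 4\<close>, too small for
  \<open>n > 4 * C\<close>. For an edge with degree sum at least \<open>n\<close>, the two
  neighbourhoods are disjoint, hence partition \<open>V\<close>, and both are independent.\<close>

lemma triangle_free_bipartition:
  assumes sg: "simple_graph (V, E)" and tf: "triangle_free E"
    and ce: "real (card V) ^ 2 / 4 - C \<le> real (card E)" and n: "real (card V) > 4 * C" "0 \<le> C" "card V \<ge> 2"
  obtains A B where "A \<union> B = V" "A \<inter> B = {}" "\<And>u v. {u, v} \<in> E \<Longrightarrow> u \<in> A \<longleftrightarrow> v \<in> B"
proof -
  note S = simple_graphD[OF sg]
  define d where "d u = (\<Sum>v\<in>V. adj E u v)" for u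
  define n where "n = real (card V)"
  define m where "m = real (card E)"
  have n0: "n > 0" "n > 4 * C" "n \<ge> 2" using n by (auto simp: n_def)
  have dd: "(\<Sum>u\<in>V. d u) = 2 * m" using handshake[OF sg] by (simp add: d_def m_def)
  have "4 * m \<ge> n\<^sup>2 - 4 * C" using ce by (simp add: n_def m_def)
  moreover have "n\<^sup>2 \<ge> 2 * n" using n0 by (simp add: power2_eq_square)
  ultimately have m0: "m > 0" using n0 by linarith
  have "\<exists>u v. {u, v} \<in> E \<and> d u + d v \<ge> n"
  proof (rule ccontr)
    assume neg: "\<not> ?thesis"
    \<comment> \<open>Degrees are integers, so a sum below \<open>n\<close> is at most
      \<open>n - 1\<close>; this unit is what beats the deficit \<open>C\<close>.\<close>
    have small: "d u + d v \<le> n - 1" if "{u, v} \<in> E" for u v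
    proof -
      have "d u + d v < n" using neg that by force
      hence "card {w\<in>V. {u, w} \<in> E} + card {w\<in>V. {v, w} \<in> E} < card V"
        unfolding d_def n_def sum_adj[OF S(1)] by linarith
      thus ?thesis unfolding d_def n_def sum_adj[OF S(1)] by linarith
    qed
    have "(2 * m)\<^sup>2 = (\<Sum>u\<in>V. 1 * d u)\<^sup>2" using dd by simp
    also have "\<dots> \<le> (\<Sum>u\<in>V. 1\<^sup>2) * (\<Sum>u\<in>V. (d u)\<^sup>2)" by (rule Cauchy_Schwarz_ineq_sum)
    also have "\<dots> = n * (\<Sum>u\<in>V. (d u)\<^sup>2)" by (simp add: n_def)
    finally have 1: "(2 * m)\<^sup>2 \<le> n * (\<Sum>u\<in>V. (d u)\<^sup>2)" .
    have e1: "(\<Sum>u\<in>V. \<Sum>v\<in>V. adj E u v * d u) = (\<Sum>u\<in>V. (d u)\<^sup>2)"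
      by (simp add: sum_distrib_right[symmetric] d_def[symmetric] power2_eq_square)
    have e2: "(\<Sum>u\<in>V. \<Sum>v\<in>V. adj E u v * d v) = (\<Sum>u\<in>V. (d u)\<^sup>2)"
      unfolding e1[symmetric] by (subst sum.swap) (simp add: adj_commute)
    have "2 * (\<Sum>u\<in>V. (d u)\<^sup>2) = (\<Sum>u\<in>V. \<Sum>v\<in>V. adj E u v * (d u + d v))"
      using e1 e2 by (simp add: distrib_left sum.distrib)
    also have "\<dots> \<le> (\<Sum>u\<in>V. \<Sum>v\<in>V. adj E u v * (n - 1))"
      by (intro sum_mono) (auto simp: adj_def small)
    also have "\<dots> = 2 * m * (n - 1)" using handshake[OF sg] by (simp add: m_def sum_distrib_right[symmetric])
    finally have "n * (2 * (\<Sum>u\<in>V. (d u)\<^sup>2)) \<le> n * (2 * m * (n - 1))"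
      using n0 by (intro mult_left_mono) auto
    with 1 have "2 * (2 * m)\<^sup>2 \<le> n * (2 * m * (n - 1))" by linarith
    hence "(2 * m) * (4 * m) \<le> (2 * m) * (n * (n - 1))" by (simp add: power2_eq_square mult_ac)
    hence "4 * m \<le> n * (n - 1)" using m0 by (simp add: mult_le_cancel_left)
    with \<open>4 * m \<ge> n\<^sup>2 - 4 * C\<close> n0 show False by (simp add: power2_eq_square algebra_simps)
  qed
  then obtain u v where uv: "{u, v} \<in> E" "d u + d v \<ge> n" by blast
  define A where "A = {w\<in>V. {v, w} \<in> E}"
  define B where "B = {w\<in>V. {u, w} \<in> E}"
  have disj: "A \<inter> B = {}" using tf uv by (auto simp: A_def B_def triangle_free_def insert_commute)
  have "card V \<le> card B + card A"
    using uv(2) unfolding d_def n_def sum_adj[OF S(1)] A_def[symmetric] B_def[symmetric] by linarith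
  also have "\<dots> = card (A \<union> B)"
    using disj S(1) by (subst card_Un_disjoint) (auto simp: A_def B_def)
  finally have un: "A \<union> B = V" using S(1) by (intro card_seteq) (auto simp: A_def B_def)
  have "a \<in> A \<longleftrightarrow> b \<in> B" if ab: "{a, b} \<in> E" for a b
  proof -
    have "\<not> (a \<in> A \<and> b \<in> A)" "\<not> (a \<in> B \<and> b \<in> B)"
      using tf ab by (auto simp: A_def B_def triangle_free_def)
    thus ?thesis using S(5)[OF ab] un disj by blast
  qed
  with un disj show ?thesis by (rule that)
qed

subsection \<open>Edge-disjoint triangles\<close>

text \<open>The empty vertex set is a placeholder: \<open>triangles\<close> looks at edges only, so
  packings depend on the edge set alone.\<close>

definition packing :: "'a set set \<Rightarrow> 'a set set set \<Rightarrow> bool" where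
  "packing E S \<longleftrightarrow> S \<subseteq> triangles ({}, E) \<and> finite S \<and> pairwise disjnt S"

lemma triangles_edges: "triangles (V, E) = triangles ({}, E)"
  by (simp add: triangles_def)

lemma packing_subset: "packing E S \<Longrightarrow> S' \<subseteq> S \<Longrightarrow> packing E S'"
  unfolding packing_def by (meson finite_subset order_trans pairwise_subset)

text \<open>An embedding is injective on vertices, hence on edges, hence on triangles as sets of
  edges. Taking images therefore preserves both the disjointness and the number of
  triangles.\<close>

lemma packing_of_subgraph:
  assumes H: "simple_graph H" and S: "packing (edges H) S" and G: "contains_subgraph G H"
  shows "\<exists>S'. packing (edges G) S' \<and> card S' = card S"
proof -
  obtain f where f: "inj_on f (verts H)" "\<And>e. e \<in> edges H \<Longrightarrow> f ` e \<in> edges G"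
    using G unfolding contains_subgraph_def by blast
  note SH = simple_graphD[of "verts H" "edges H", simplified, OF H]
  have inj: "inj_on ((`) f) (edges H)"
    using f(1) SH(3) by (intro inj_onI) (meson inj_on_image_eq_iff)
  have TE: "T \<subseteq> edges H" if "T \<in> S" for T using S that by (auto simp: packing_def triangles_def)
  define g where "g T = (`) f ` T" for T
  have ginj: "inj_on g S"
    unfolding g_def using inj TE by (intro inj_onI) (meson inj_on_image_eq_iff)
  have tri: "g T \<in> triangles ({}, edges G)" if T: "T \<in> S" for T
  proof -
    obtain a b c where abc: "a \<noteq> b" "b \<noteq> c" "a \<noteq> c" "T = {{a, b}, {b, c}, {a, c}}"
      using S T unfolding packing_def triangles_def by blast
    hence "a \<in> verts H" "b \<in> verts H" "c \<in> verts H" using TE[OF T] SH(5) by blast+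
    hence "f a \<noteq> f b" "f b \<noteq> f c" "f a \<noteq> f c"
      using abc f(1) by (auto dest: inj_onD)
    moreover have "g T = {{f a, f b}, {f b, f c}, {f a, f c}}" by (simp add: g_def abc)
    moreover have "g T \<subseteq> edges G" using TE[OF T] f(2) by (auto simp: g_def)
    ultimately show ?thesis unfolding triangles_def snd_conv by blast
  qed
  have dis: "disjnt (g T) (g T')" if "T \<in> S" "T' \<in> S" "T \<noteq> T'" for T T'
  proof -
    have "T \<inter> T' = {}" using S that by (auto simp: packing_def pairwise_def disjnt_def)
    hence "g T \<inter> g T' = {}"
      unfolding g_def using inj_on_image_Int[OF inj TE TE, of T T'] that by simp
    thus ?thesis by (simp add: disjnt_def)
  qed
  have "packing (edges G) (g ` S)"
    unfolding packing_def using tri dis S by (auto simp: packing_def pairwise_image pairwise_def)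
  thus ?thesis using card_image[OF ginj] by blast
qed

text \<open>A packing with at least \<open>k\<close> members can be cut down to exactly
  \<open>k\<close>, and then \<open>G\<close> itself belongs to \<open>Gamma k\<close> and is
  contained in \<open>G\<close>. In the other direction, a subgraph from \<open>Gamma k\<close>
  carries its packing into \<open>G\<close>.\<close>

lemma free_graphs_Gamma_iff:
  fixes G :: "'a graph"
  shows "G \<in> free_graphs n (Gamma k) \<longleftrightarrow> simple_graph G \<and> card (verts G) = n \<and>
    (\<forall>S. packing (edges G) S \<longrightarrow> card S < k)"
proof -
  have G: "triangles G = triangles ({}, edges G)" using triangles_edges[of "verts G" "edges G"] by simp
  have "(\<forall>H\<in>(Gamma k :: 'a graph set). \<not> contains_subgraph G H) \<longleftrightarrow> (\<forall>S. packing (edges G) S \<longrightarrow> card S < k)"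
    if sg: "simple_graph G"
  proof (intro iffI allI impI ballI)
    fix S assume free: "\<forall>H\<in>(Gamma k :: 'a graph set). \<not> contains_subgraph G H" and S: "packing (edges G) S"
    show "card S < k"
    proof (rule ccontr)
      assume "\<not> card S < k"
      hence "k \<le> card S" by simp
      from obtain_subset_with_card_n[OF this]
      obtain S' where S': "S' \<subseteq> S" "card S' = k" by metis
      hence "packing (edges G) S'" using packing_subset[OF S] by blast
      hence "S' \<subseteq> triangles G \<and> finite S' \<and> card S' = k \<and> pairwise disjnt S'"
        using S'(2) unfolding G packing_def by simp
      hence "G \<in> Gamma k" using sg unfolding Gamma_def by blast
      moreover have "contains_subgraph G G"
        unfolding contains_subgraph_def by (intro exI[of _ id]) auto
      ultimately show False using free by blast
    qed
  next
    fix H :: "'a graph"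
    assume pk: "\<forall>S. packing (edges G) S \<longrightarrow> card S < k" and H: "H \<in> Gamma k"
    obtain S where S: "simple_graph H" "S \<subseteq> triangles H" "finite S" "card S = k" "pairwise disjnt S"
      using H by (auto simp: Gamma_def)
    have "triangles H = triangles ({}, edges H)" using triangles_edges[of "verts H" "edges H"] by simp
    hence "packing (edges H) S" using S by (simp add: packing_def)
    show "\<not> contains_subgraph G H"
    proof
      assume "contains_subgraph G H"
      from packing_of_subgraph[OF S(1) \<open>packing (edges H) S\<close> this] S(4)
      obtain S' where "packing (edges G) S'" "card S' = k" by auto
      with pk show False by auto
    qed
  qed
  thus ?thesis unfolding free_graphs_def mem_Collect_eq by metis
qed

lemma card_triangle_le:
  assumes "T \<in> triangles G"
  shows "card T \<le> 3"
proof -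
  have "card {x, y, z} \<le> 3" for x y z :: "'a set" by (simp add: card_insert_if)
  thus ?thesis using assms unfolding triangles_def by blast
qed

text \<open>A triangle avoiding all edges of a packing of maximum size could be added to it.
  Deleting the at most \<open>3 * m\<close> edges of such a packing therefore destroys every
  triangle.\<close>

lemma triangle_free_deletion:
  assumes sg: "simple_graph (V, E)" and free: "\<forall>S. packing E S \<longrightarrow> card S \<le> m"
  obtains D where "D \<subseteq> E" "card D \<le> 3 * m" "triangle_free (E - D)"
proof -
  have "packing E {}" by (simp add: packing_def)
  moreover have "\<forall>S. packing E S \<longrightarrow> card S < Suc m" using free by (simp add: less_Suc_eq_le)
  ultimately have "\<exists>S. packing E S \<and> (\<forall>S'. packing E S' \<longrightarrow> card S' \<le> card S)"
    by (rule Lattices_Big.ex_has_greatest_nat)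
  then obtain S where S: "packing E S" and max: "\<And>S'. packing E S' \<Longrightarrow> card S' \<le> card S" by blast
  have fin: "finite S" and tri: "\<And>T. T \<in> S \<Longrightarrow> T \<in> triangles ({}, E)"
    using S by (auto simp: packing_def)
  have "card (\<Union>S) \<le> (\<Sum>T\<in>S. card T)" by (rule card_Union_le_sum_card)
  also have "\<dots> \<le> (\<Sum>T\<in>S. 3)" by (intro sum_mono card_triangle_le[OF tri])
  also have "\<dots> \<le> 3 * m" using free S by simp
  finally have "card (\<Union>S) \<le> 3 * m" .
  moreover have "\<Union>S \<subseteq> E" using tri by (auto simp: triangles_def)
  moreover have "triangle_free (E - \<Union>S)"
    unfolding triangle_free_def
  proof (intro allI impI)
    fix u v w assume uvw: "{u, v} \<in> E - \<Union>S" "{v, w} \<in> E - \<Union>S" "{u, w} \<in> E - \<Union>S"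
    define T where "T = {{u, v}, {v, w}, {u, w}}"
    have "u \<noteq> v" "v \<noteq> w" "u \<noteq> w" using uvw simple_graphD(5)[OF sg] by blast+
    hence T: "T \<in> triangles ({}, E)" using uvw by (auto simp: triangles_def T_def)
    have dis: "T \<inter> T' = {}" if "T' \<in> S" for T' using uvw that by (auto simp: T_def)
    have "T \<notin> S" using dis[of T] by (auto simp: T_def)
    have "packing E (insert T S)"
      using S T dis by (auto simp: packing_def pairwise_insert disjnt_def)
    from max[OF this] \<open>T \<notin> S\<close> fin show False by simp
  qed
  ultimately show ?thesis by (intro that[of "\<Union>S"])
qed

text \<open>Greedy choice: when an element is treated, fewer than \<open>card K\<close>
  representatives are taken, so its set still offers a new one.\<close>

lemma distinct_representatives:
  assumes "finite K" "\<And>e. e \<in> K \<Longrightarrow> finite (W e)" "\<And>e. e \<in> K \<Longrightarrow> card K \<le> card (W e)"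
  shows "\<exists>w. inj_on w K \<and> (\<forall>e\<in>K. w e \<in> W e)"
  using assms
proof (induction K rule: finite_induct)
  case (insert x K)
  have "card K \<le> card (W e)" if "e \<in> K" for e
    using insert.prems(2)[of e] insert.hyps that by simp
  then obtain w where w: "inj_on w K" "\<forall>e\<in>K. w e \<in> W e" using insert.IH insert.prems(1) by blast
  have "card (w ` K) < card (W x)"
    using insert.prems(2)[of x] insert.hyps card_image_le[of K w] by simp
  hence "\<not> W x \<subseteq> w ` K" using insert.hyps by (meson card_mono finite_imageI linorder_not_less)
  then obtain y where y: "y \<in> W x" "y \<notin> w ` K" by blast
  have "inj_on (w(x := y)) (insert x K)"
    using w y insert.hyps by (auto simp: inj_on_def)
  moreover have "\<forall>e\<in>insert x K. (w(x := y)) e \<in> W e" using w y by auto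
  ultimately show ?case by blast
qed auto

text \<open>Distinct apexes outside the span of \<open>K\<close> make the triangles over the edges of \<open>K\<close> edge-disjoint.\<close>

lemma packing_from_apexes:
  assumes sg: "simple_graph (V, E)" and K: "K \<subseteq> E"
    and apex: "\<And>e. e \<in> K \<Longrightarrow> card K \<le> card {w\<in>V. w \<notin> \<Union>K \<and> (\<forall>u\<in>e. {u, w} \<in> E)}"
  obtains S where "packing E S" "card S = card K"
proof -
  note SG = simple_graphD[OF sg]
  have fK: "finite K" using K SG(2) finite_subset by blast
  have "\<exists>w. inj_on w K \<and> (\<forall>e\<in>K. w e \<in> {w\<in>V. w \<notin> \<Union>K \<and> (\<forall>u\<in>e. {u, w} \<in> E)})"
    using SG(1) by (intro distinct_representatives[OF fK] apex) auto
  then obtain w where w: "inj_on w K" "\<And>e. e \<in> K \<Longrightarrow> w e \<notin> \<Union>K"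
      "\<And>e u. e \<in> K \<Longrightarrow> u \<in> e \<Longrightarrow> {u, w e} \<in> E" by auto
  define T where "T e = insert e ((\<lambda>u. {u, w e}) ` e)" for e
  have T: "T e \<in> triangles ({}, E)" if e: "e \<in> K" for e
  proof -
    have "card e = 2" using e K SG(4) by blast
    then obtain x y where xy: "e = {x, y}" "x \<noteq> y" by (auto simp: card_2_iff)
    hence ne: "x \<noteq> w e" "y \<noteq> w e" using w(2)[OF e] e by auto
    have "T e = {{x, y}, {y, w e}, {x, w e}}" using xy by (auto simp: T_def)
    moreover have "T e \<subseteq> E" using e K w(3)[OF e] by (auto simp: T_def)
    ultimately show ?thesis unfolding triangles_def snd_conv using xy ne by blast
  qed
  \<comment> \<open>A common edge would identify the two apexes or put an apex into the span of
    \<open>K\<close>.\<close>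
  have dis: "T e \<inter> T e' = {}" if "e \<in> K" "e' \<in> K" "e \<noteq> e'" for e e'
  proof -
    have "w e \<noteq> w e'" using w(1) that by (auto dest: inj_onD)
    thus ?thesis using that w(2)[OF that(1)] w(2)[OF that(2)]
      by (auto simp: T_def doubleton_eq_iff)
  qed
  have inj: "inj_on T K"
  proof (rule inj_onI)
    fix e e' assume ee: "e \<in> K" "e' \<in> K" "T e = T e'"
    have "e \<in> T e" by (simp add: T_def)
    thus "e = e'" using dis[OF ee(1,2)] ee(3) by blast
  qed
  have "packing E (T ` K)"
    using T dis fK unfolding packing_def by (auto simp: pairwise_image pairwise_def disjnt_def)
  with card_image[OF inj] show ?thesis using that by blast
qed

section \<open>Structure of dense graphs without large triangle packings\<close>

lemma card_edges_bipartition: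
  assumes sg: "simple_graph (V, E)" and AB: "A \<union> B = V" "A \<inter> B = {}"
  shows "card E = card {e\<in>E. e \<subseteq> A \<or> e \<subseteq> B} + card {(u, v)\<in>A \<times> B. {u, v} \<in> E}"
proof -
  note S = simple_graphD[OF sg]
  let ?X = "{(u, v)\<in>A \<times> B. {u, v} \<in> E}" and ?f = "\<lambda>(u, v). {u, v}"
  have inj: "inj_on ?f ?X" using AB by (auto simp: inj_on_def doubleton_eq_iff)
  have "E - {e\<in>E. e \<subseteq> A \<or> e \<subseteq> B} = ?f ` ?X"
  proof (intro equalityI subsetI)
    fix e assume e: "e \<in> E - {e\<in>E. e \<subseteq> A \<or> e \<subseteq> B}"
    hence "card e = 2" "e \<subseteq> V" using S by auto
    then obtain x y where xy: "e = {x, y}" by (auto simp: card_2_iff)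
    hence "(x \<in> A \<and> y \<in> B) \<or> (y \<in> A \<and> x \<in> B)" using e AB \<open>e \<subseteq> V\<close> by auto
    moreover have "e = {y, x}" "e \<in> E" using xy e by auto
    ultimately have "(x, y) \<in> ?X \<and> e = ?f (x, y) \<or> (y, x) \<in> ?X \<and> e = ?f (y, x)"
      using xy by auto
    thus "e \<in> ?f ` ?X" by blast
  qed (use AB in auto)
  hence "card (E - {e\<in>E. e \<subseteq> A \<or> e \<subseteq> B}) = card ?X" using card_image[OF inj] by simp
  moreover have "card {e\<in>E. e \<subseteq> A \<or> e \<subseteq> B} \<le> card E" using S(2) by (intro card_mono) auto
  moreover have "card (E - {e\<in>E. e \<subseteq> A \<or> e \<subseteq> B}) = card E - card {e\<in>E. e \<subseteq> A \<or> e \<subseteq> B}"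
    using S(2) by (intro card_Diff_subset) auto
  ultimately show ?thesis by simp
qed

lemma four_mult_le_square_add: "4 * (a * b) \<le> (a + b)\<^sup>2" for a b :: nat
proof -
  have "4 * (int a * int b) \<le> (int a + int b)\<^sup>2"
    using zero_le_power2[of "int a - int b"] by (simp add: power2_eq_square algebra_simps)
  thus ?thesis by (metis (mono_tags) of_nat_add of_nat_le_iff of_nat_mult of_nat_numeral of_nat_power)
qed

text \<open>Over the integers the hypothesis reads \<open>(a - b)^2 \<le> 4 * C\<close>, and
  \<open>4 * C < (2 * C + 1)^2\<close>.\<close>

lemma near_balanced:
  fixes a b C :: nat
  assumes "(a + b)\<^sup>2 \<le> 4 * (a * b) + 4 * C"
  shows "a \<le> b + 2 * C"
proof (rule ccontr)
  assume neg: "\<not> a \<le> b + 2 * C"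
  define d where "d = a - b"
  have d: "a = b + d" "d \<ge> 2 * C + 1" using neg by (simp_all add: d_def)
  have "d * d \<le> 4 * C" using assms d(1) by (simp add: power2_eq_square algebra_simps)
  moreover have "(2 * C + 1) * (2 * C + 1) \<le> d * d" using d(2) by (intro mult_mono) auto
  ultimately show False by (simp add: algebra_simps)
qed

text \<open>After the deletion of at most \<open>3 * m\<close> edges the graph is bipartite, and its
  parts serve for \<open>E\<close> as well. At most \<open>C + 3 * m\<close> cross pairs are
  missing, so the ends of an inner edge have almost the whole opposite part as common neighbours.
  With \<open>m + 1\<close> inner edges there would be distinct apexes for all of them, hence a
  packing of size \<open>m + 1\<close>.\<close>

lemma packing_free_structure:
  fixes V :: "'a set"
  assumes sg: "simple_graph (V, E)" and free: "\<forall>S. packing E S \<longrightarrow> card S \<le> m"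
    and edges: "(card V)\<^sup>2 \<le> 4 * card E + 4 * C"
    and large: "card V \<ge> 8 * (C + 3 * m) + 8 * m + 8"
  shows "\<exists>A B. A \<union> B = V \<and> A \<inter> B = {} \<and> card {e\<in>E. e \<subseteq> A \<or> e \<subseteq> B} \<le> m \<and>
    (card V)\<^sup>2 \<le> 4 * card {(u, v)\<in>A \<times> B. {u, v} \<in> E} + 4 * (C + 3 * m)"
proof -
  note SG = simple_graphD[OF sg]
  \<comment> \<open>The deficit \<open>C\<close> of the hypothesis grows by the number of deleted
    edges.\<close>
  define C' where "C' = C + 3 * m"
  obtain D where D: "D \<subseteq> E" "card D \<le> 3 * m" "triangle_free (E - D)"
    using triangle_free_deletion[OF sg free] by blast
  have "card E \<le> card (E - D) + 3 * m"
    using D(1,2) SG(2) by (simp add: card_Diff_subset finite_subset)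
  hence e0: "(card V)\<^sup>2 \<le> 4 * card (E - D) + 4 * C'" using edges by (simp add: C'_def)
  have sg0: "simple_graph (V, E - D)" using sg by (auto simp: simple_graph_def)
  have "real ((card V)\<^sup>2) \<le> real (4 * card (E - D) + 4 * C')" using e0 of_nat_le_iff by blast
  hence r: "real (card V) ^ 2 / 4 - real C' \<le> real (card (E - D))" by simp
  have r2: "real (card V) > 4 * real C'" "card V \<ge> 2" using large by (auto simp: C'_def)
  obtain A B where AB: "A \<union> B = V" "A \<inter> B = {}"
      and cross: "\<And>u v. {u, v} \<in> E - D \<Longrightarrow> u \<in> A \<longleftrightarrow> v \<in> B"
    by (rule triangle_free_bipartition[OF sg0 D(3) r r2(1) of_nat_0_le_iff r2(2)]) (rule that)
  have fin: "finite A" "finite B"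
    using finite_subset[OF _ SG(1), of A] finite_subset[OF _ SG(1), of B] AB(1) by blast+
  have n: "card V = card A + card B" using card_Un_disjoint[OF fin AB(2)] AB(1) by simp
  define X where "X = {(u, v)\<in>A \<times> B. {u, v} \<in> E}"
  have Xs: "X \<subseteq> A \<times> B" by (auto simp: X_def)
  have finX: "finite X" using finite_subset[OF Xs] fin by simp
  have "{e\<in>E - D. e \<subseteq> A \<or> e \<subseteq> B} = {}"
  proof -
    have "\<not> (e \<subseteq> A \<or> e \<subseteq> B)" if "e \<in> E - D" for e
    proof -
      have "card e = 2" using that SG(4) by blast
      then obtain x y where "e = {x, y}" by (auto simp: card_2_iff)
      thus ?thesis using cross[of x y] that AB(2) by blast
    qed
    thus ?thesis by blast
  qed
  from card_edges_bipartition[OF sg0 AB, unfolded this]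
  have "card (E - D) = card {(u, v)\<in>A \<times> B. {u, v} \<in> E - D}" by simp
  also have "\<dots> \<le> card X" using finX by (intro card_mono) (auto simp: X_def)
  finally have X: "(card V)\<^sup>2 \<le> 4 * card X + 4 * C'" using e0 by simp
  have Xle: "card X \<le> card A * card B"
    using card_mono[OF _ Xs] fin by (simp add: card_cartesian_product)
  have "card (A \<times> B - X) = card A * card B - card X"
    using Xs finX by (simp add: card_Diff_subset card_cartesian_product)
  \<comment> \<open>The deficit is measured from \<open>n^2/4\<close>, which is at least
    \<open>card A * card B\<close>; hence it also bounds the number of missing cross pairs.\<close>
  hence M: "card (A \<times> B - X) \<le> C'"
    using X four_mult_le_square_add[of "card A" "card B"] n by simp
  have finM: "finite (A \<times> B - X)" using fin by blast
  have missA: "card {v\<in>B. {u, v} \<notin> E} \<le> C'" if "u \<in> A" for u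
  proof -
    have "Pair u ` {v\<in>B. {u, v} \<notin> E} \<subseteq> A \<times> B - X" using that by (auto simp: X_def)
    from card_mono[OF finM this] M show ?thesis by (simp add: card_image inj_on_def)
  qed
  have missB: "card {u\<in>A. {v, u} \<notin> E} \<le> C'" if "v \<in> B" for v
  proof -
    have "(\<lambda>u. (u, v)) ` {u\<in>A. {v, u} \<notin> E} \<subseteq> A \<times> B - X"
      using that by (auto simp: X_def insert_commute)
    from card_mono[OF finM this] M show ?thesis by (simp add: card_image inj_on_def)
  qed
  have bal: "(card A + card B)\<^sup>2 \<le> 4 * (card A * card B) + 4 * C'" using X Xle n by simp
  hence "card A \<le> card B + 2 * C'" "card B \<le> card A + 2 * C'"
    using near_balanced[of "card A" "card B" C'] near_balanced[of "card B" "card A" C']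
    by (simp_all add: mult.commute add.commute)
  \<comment> \<open>A part of this size leaves \<open>m + 1\<close> apexes: \<open>2 * C'\<close>
    covers the non-neighbours of the two ends of an edge, and \<open>2 * m + 2\<close> the span of
    \<open>m + 1\<close> edges.\<close>
  hence big: "card A \<ge> 2 * C' + 3 * m + 3" "card B \<ge> 2 * C' + 3 * m + 3"
    using large n by (auto simp: C'_def)
  have "card {e\<in>E. e \<subseteq> A \<or> e \<subseteq> B} \<le> m"
  proof (rule ccontr)
    assume "\<not> ?thesis"
    hence "m + 1 \<le> card {e\<in>E. e \<subseteq> A \<or> e \<subseteq> B}" by simp
    from obtain_subset_with_card_n[OF this]
    obtain K where K: "K \<subseteq> {e\<in>E. e \<subseteq> A \<or> e \<subseteq> B}" "card K = m + 1" by metis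
    have fK: "finite K" using K(2) by (intro card_ge_0_finite) simp
    have KE: "\<And>e. e \<in> K \<Longrightarrow> e \<in> E" using K(1) by blast
    have "card (\<Union>K) \<le> (\<Sum>e\<in>K. card e)" by (rule card_Union_le_sum_card)
    also have "\<dots> = (\<Sum>e\<in>K. 2)" using KE SG(4) by (intro sum.cong) auto
    also have "\<dots> = 2 * (m + 1)" using K(2) by simp
    finally have cU: "card (\<Union>K) \<le> 2 * (m + 1)" .
    have fU: "finite (\<Union>K)"
    proof (rule finite_Union[OF fK])
      fix e assume "e \<in> K"
      from finite_subset[OF SG(3)[OF KE[OF this]] SG(1)] show "finite e" .
    qed
    have apex: "card K \<le> card {w\<in>V. w \<notin> \<Union>K \<and> (\<forall>u\<in>e. {u, w} \<in> E)}"
      if Q: "P \<subseteq> V" "e \<in> K" "card P \<ge> 2 * C' + 3 * m + 3"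
        "\<And>u. u \<in> e \<Longrightarrow> card {v\<in>P. {u, v} \<notin> E} \<le> C'" for P e
    proof -
      have fP: "finite P" using Q(1) SG(1) finite_subset by blast
      have "card e = 2" using KE[OF Q(2)] SG(4) by blast
      then obtain x y where xy: "e = {x, y}" by (auto simp: card_2_iff)
      let ?Mx = "{v\<in>P. {x, v} \<notin> E}" and ?My = "{v\<in>P. {y, v} \<notin> E}"
      let ?W = "{w\<in>V. w \<notin> \<Union>K \<and> (\<forall>u\<in>e. {u, w} \<in> E)}"
      have "P \<subseteq> ?W \<union> \<Union>K \<union> ?Mx \<union> ?My" using Q(1) xy by auto
      hence "card P \<le> card (?W \<union> \<Union>K \<union> ?Mx \<union> ?My)" using fP fU SG(1) by (intro card_mono) auto
      also have "\<dots> \<le> card ?W + card (\<Union>K) + card ?Mx + card ?My"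
        using card_Un_le[of "?W \<union> \<Union>K \<union> ?Mx" ?My] card_Un_le[of "?W \<union> \<Union>K" ?Mx]
          card_Un_le[of ?W "\<Union>K"] by linarith
      finally show ?thesis using Q(3) Q(4)[of x] Q(4)[of y] xy cU K(2) by simp
    qed
    have "card K \<le> card {w\<in>V. w \<notin> \<Union>K \<and> (\<forall>u\<in>e. {u, w} \<in> E)}" if e: "e \<in> K" for e
    proof (cases "e \<subseteq> A")
      case True
      thus ?thesis using AB(1) missA by (intro apex[of B] e big) auto
    next
      case False
      hence "e \<subseteq> B" using e K by blast
      thus ?thesis using AB(1) missB by (intro apex[of A] e big) auto
    qed
    note rep = this
    have "K \<subseteq> E" using K(1) by blast
    from packing_from_apexes[OF sg this rep]
    obtain S where "packing E S" "card S = card K" by metis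
    thus False using free[rule_format, of S] K(2) by simp
  qed
  with AB X show ?thesis unfolding X_def C'_def by blast
qed

subsection \<open>Subinvariant vectors of nearly complete bipartite graphs\<close>

definition deg :: "'a set \<Rightarrow> 'a set set \<Rightarrow> 'a \<Rightarrow> real" where
  "deg A F u = (\<Sum>v\<in>A. adj F u v)"

definition w1 :: "'a set \<Rightarrow> 'a set set \<Rightarrow> real" where
  "w1 A F = (\<Sum>u\<in>A. deg A F u)"

text \<open>The number of walks of length two inside \<open>A\<close>, sorted by their middle
  vertex.\<close>

definition w2 :: "'a set \<Rightarrow> 'a set set \<Rightarrow> real" where
  "w2 A F = (\<Sum>u\<in>A. (deg A F u)\<^sup>2)"

text \<open>The number of walks of length three inside \<open>A\<close>, sorted by their oriented
  middle edge.\<close>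

definition w3 :: "'a set \<Rightarrow> 'a set set \<Rightarrow> real" where
  "w3 A F = (\<Sum>u\<in>A. \<Sum>v\<in>A. adj F u v * deg A F u * deg A F v)"

text \<open>If \<open>m\<close> bounds the maximum degree, the last denominator absorbs the tail of the walk series.\<close>

definition gain :: "'a set \<Rightarrow> 'a set set \<Rightarrow> real \<Rightarrow> real \<Rightarrow> real" where
  "gain A F m l = w1 A F + w2 A F / l + w3 A F / (l * (l - m))"

lemma deg_nonneg [simp]: "0 \<le> deg A F u"
  by (simp add: deg_def sum_nonneg)

lemma walks_nonneg: "0 \<le> w1 A F" "0 \<le> w2 A F" "0 \<le> w3 A F"
  by (auto simp: w1_def w2_def w3_def intro!: sum_nonneg mult_nonneg_nonneg)

lemma gain_nonneg: "0 \<le> m \<Longrightarrow> m < l \<Longrightarrow> 0 \<le> gain A F m l"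
  using walks_nonneg[of A F] by (auto simp: gain_def)

text \<open>The adjacency operator of \<open>F\<close> on \<open>A\<close> is self-adjoint; this
  moves it from \<open>h\<close> to \<open>g\<close>.\<close>

lemma sum_adj_swap: "(\<Sum>u\<in>A. g u * (\<Sum>w\<in>A. adj F u w * h w)) = (\<Sum>w\<in>A. (\<Sum>u\<in>A. adj F w u * g u) * h w)"
  by (simp add: sum_distrib_left sum_distrib_right, subst sum.swap) (simp add: adj_commute mult_ac)

text \<open>\<open>S\<close> stands for the total weight of the opposite part. The first bound is
  the maximum principle at a vertex where \<open>y\<close> is largest. For the second, the
  inequality \<open>h\<close> is paired with the iterated images of the constant 1 under the
  adjacency operator, whose sums are \<open>w1\<close>, \<open>w2\<close> and \<open>w3\<close>; the
  term left after three steps is estimated by the first bound, which produces the denominator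
  \<open>l - m\<close>.\<close>

lemma inner_walk_bounds:
  fixes y :: "'a \<Rightarrow> real"
  assumes fin: "finite A" and y: "\<And>u. u \<in> A \<Longrightarrow> 0 \<le> y u" and m: "0 \<le> m" "m < l" and S: "0 \<le> S"
    and h: "\<And>u. u \<in> A \<Longrightarrow> l * y u \<le> S + (\<Sum>w\<in>A. adj F u w * y w)"
    and d: "\<And>u. u \<in> A \<Longrightarrow> deg A F u \<le> m"
  shows "\<And>u. u \<in> A \<Longrightarrow> (l - m) * y u \<le> S"
    and "l * (\<Sum>u\<in>A. deg A F u * y u) \<le> S * gain A F m l"
proof -
  show max: "(l - m) * y u \<le> S" if u: "u \<in> A" for u
  proof -
    obtain x where x: "x \<in> A" "\<And>v. v \<in> A \<Longrightarrow> y v \<le> y x"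
      using obtains_MAX[OF fin, of y] u by (metis Max_ge empty_iff fin finite_imageI image_eqI)
    have "l * y x \<le> S + (\<Sum>w\<in>A. adj F x w * y x)"
      using x by (intro order_trans[OF h[OF x(1)]] add_left_mono sum_mono mult_left_mono) auto
    also have "(\<Sum>w\<in>A. adj F x w * y x) = deg A F x * y x" by (simp add: deg_def sum_distrib_right)
    also have "\<dots> \<le> m * y x" using d y x by (intro mult_right_mono) auto
    finally have "(l - m) * y x \<le> S" by (simp add: algebra_simps)
    moreover have "(l - m) * y u \<le> (l - m) * y x" using x(2)[OF u] m by (intro mult_left_mono) auto
    ultimately show ?thesis by linarith
  qed
  \<comment> \<open>Pairing with a nonnegative \<open>g\<close> trades one factor \<open>l\<close>
    for one application of the adjacency operator to \<open>g\<close>.\<close>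
  have step: "l * (\<Sum>u\<in>A. g u * y u) \<le> S * (\<Sum>u\<in>A. g u) + (\<Sum>u\<in>A. (\<Sum>w\<in>A. adj F u w * g w) * y u)"
    if g: "\<And>u. u \<in> A \<Longrightarrow> 0 \<le> g u" for g
  proof -
    have "l * (\<Sum>u\<in>A. g u * y u) = (\<Sum>u\<in>A. g u * (l * y u))"
      by (simp add: sum_distrib_left mult_ac)
    also have "\<dots> \<le> (\<Sum>u\<in>A. g u * (S + (\<Sum>w\<in>A. adj F u w * y w)))"
      using g h by (intro sum_mono mult_left_mono) auto
    also have "\<dots> = S * (\<Sum>u\<in>A. g u) + (\<Sum>u\<in>A. g u * (\<Sum>w\<in>A. adj F u w * y w))"
      by (simp add: distrib_left sum.distrib sum_distrib_left mult_ac)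
    finally show ?thesis by (simp add: sum_adj_swap)
  qed
  define d2 where "d2 u = (\<Sum>w\<in>A. adj F u w * deg A F w)" for u
  define d3 where "d3 u = (\<Sum>w\<in>A. adj F u w * d2 w)" for u
  have nn: "0 \<le> d2 u" "0 \<le> d3 u" for u by (auto simp: d2_def d3_def intro!: sum_nonneg mult_nonneg_nonneg)
  have one: "(\<Sum>u\<in>A. (\<Sum>w\<in>A. adj F u w * g w)) = (\<Sum>w\<in>A. deg A F w * g w)" for g
    using sum_adj_swap[of "\<lambda>_. 1" F g A] by (simp add: deg_def)
  have s2: "(\<Sum>u\<in>A. d2 u) = w2 A F"
    unfolding d2_def one by (simp add: w2_def power2_eq_square)
  have s3: "(\<Sum>u\<in>A. d3 u) = w3 A F"
    unfolding d3_def one by (simp add: w3_def d2_def sum_distrib_left mult_ac)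
  define Y1 where "Y1 = (\<Sum>u\<in>A. deg A F u * y u)"
  define Y2 where "Y2 = (\<Sum>u\<in>A. d2 u * y u)"
  define Y3 where "Y3 = (\<Sum>u\<in>A. d3 u * y u)"
  have 1: "l * Y1 \<le> S * w1 A F + Y2"
    using step[of "deg A F"] by (simp add: Y1_def Y2_def d2_def w1_def)
  have 2: "l * Y2 \<le> S * w2 A F + Y3"
    using step[of d2] nn by (simp add: Y2_def Y3_def d3_def s2)
  \<comment> \<open>The series is cut here; the tail \<open>Y3\<close> is bounded pointwise by
    \<open>max\<close>.\<close>
  have "(l - m) * Y3 = (\<Sum>u\<in>A. d3 u * ((l - m) * y u))" by (simp add: Y3_def sum_distrib_left mult_ac)
  also have "\<dots> \<le> (\<Sum>u\<in>A. d3 u * S)" using nn max by (intro sum_mono mult_left_mono) auto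
  also have "\<dots> = S * w3 A F" by (simp add: s3[symmetric] sum_distrib_left mult_ac)
  finally have "Y3 \<le> S * w3 A F / (l - m)" using m by (simp add: pos_le_divide_eq mult.commute)
  with 2 have "Y2 * l \<le> S * w2 A F + S * w3 A F / (l - m)" by (simp add: mult.commute[of Y2])
  hence "Y2 \<le> (S * w2 A F + S * w3 A F / (l - m)) / l" using m by (simp add: pos_le_divide_eq)
  also have "\<dots> = S * (w2 A F / l + w3 A F / (l * (l - m)))"
    using m by (simp add: add_divide_distrib distrib_left mult.commute)
  finally show "l * (\<Sum>u\<in>A. deg A F u * y u) \<le> S * gain A F m l"
    using 1 by (simp add: Y1_def gain_def distrib_left)
qed

text \<open>Summing the inequality over \<open>A\<close> and then applying the one of
  \<open>B\<close> bounds \<open>l^2 * SA\<close> by \<open>e * SA\<close> plus contributions of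
  inner edges. By \<open>inner_walk_bounds\<close> these become multiples of \<open>SA\<close>, and
  division by \<open>SA\<close> leaves a bound free of \<open>y\<close>.\<close>

lemma two_sided_walk_bound:
  fixes y :: "'a \<Rightarrow> real"
  assumes fin: "finite A" "finite B" and y: "\<And>u. 0 \<le> y u" and m: "0 \<le> m" "m < l"
    and hA: "\<And>u. u \<in> A \<Longrightarrow> l * y u \<le> (\<Sum>v\<in>B. adj E u v * y v) + (\<Sum>w\<in>A. adj F u w * y w)"
    and hB: "\<And>v. v \<in> B \<Longrightarrow> l * y v \<le> (\<Sum>u\<in>A. adj E v u * y u) + (\<Sum>w\<in>B. adj F v w * y w)"
    and dA: "\<And>u. u \<in> A \<Longrightarrow> deg A F u \<le> m" and dB: "\<And>u. u \<in> B \<Longrightarrow> deg B F u \<le> m"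
    and nz: "\<exists>v\<in>A \<union> B. y v \<noteq> 0"
  shows "l\<^sup>2 \<le> (\<Sum>u\<in>A. \<Sum>v\<in>B. adj E u v) +
    (card A * gain B F m l + card B * gain A F m l) / l + gain A F m l * gain B F m l / l\<^sup>2"
proof -
  define SA where "SA = (\<Sum>u\<in>A. y u)"
  define SB where "SB = (\<Sum>u\<in>B. y u)"
  define RA where "RA = gain A F m l"
  define RB where "RB = gain B F m l"
  define e where "e = (\<Sum>u\<in>A. \<Sum>v\<in>B. adj E u v)"
  define YA where "YA = (\<Sum>u\<in>A. deg A F u * y u)"
  define YB where "YB = (\<Sum>u\<in>B. deg B F u * y u)"
  have S0: "0 \<le> SA" "0 \<le> SB" using y by (auto simp: SA_def SB_def intro: sum_nonneg)
  have l0: "l > 0" using m by simp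
  have le1: "(\<Sum>v\<in>X. adj E u v * y v) \<le> (\<Sum>v\<in>X. y v)" for X u
    by (intro sum_mono) (auto simp: adj_def y)
  have hA': "l * y u \<le> SB + (\<Sum>w\<in>A. adj F u w * y w)" if "u \<in> A" for u
    using hA[OF that] le1[of u B] by (simp add: SB_def)
  have hB': "l * y u \<le> SA + (\<Sum>w\<in>B. adj F u w * y w)" if "u \<in> B" for u
    using hB[OF that] le1[of u A] by (simp add: SA_def)
  note bA = inner_walk_bounds[OF fin(1) y m S0(2) hA' dA, simplified]
  note bB = inner_walk_bounds[OF fin(2) y m S0(1) hB' dB, simplified]
  \<comment> \<open>If \<open>y\<close> vanished on \<open>A\<close>, the bound
    \<open>(l - m) * y u \<le> SA\<close> would make it vanish on \<open>B\<close> too.\<close>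
  have SA: "SA > 0"
  proof (rule ccontr)
    assume "\<not> ?thesis"
    hence z: "SA = 0" using S0 by simp
    hence "y u = 0" if "u \<in> A" for u
      using that fin y by (simp add: SA_def sum_nonneg_eq_0_iff)
    moreover have "y u = 0" if "u \<in> B" for u
    proof -
      have "y u \<le> 0" using bB(1)[OF that] m z by (simp add: mult_le_0_iff)
      thus ?thesis using y[of u] by simp
    qed
    ultimately show False using nz by blast
  qed
  have YA: "l * YA \<le> SB * RA" using bA(2) by (simp add: YA_def RA_def)
  have YB: "YB \<le> SA * RB / l" using bB(2) l0 by (simp add: YB_def RB_def field_simps)
  have R0: "0 \<le> RA" using gain_nonneg[OF m] by (simp add: RA_def)
  have inner: "(\<Sum>v\<in>X. \<Sum>w\<in>X. adj F v w * y w) = (\<Sum>w\<in>X. deg X F w * y w)" for X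
    using sum_adj_swap[of "\<lambda>_. 1" F y X] by (simp add: deg_def)
  \<comment> \<open>The bound on \<open>YA\<close> is in terms of \<open>SB\<close>, so
    \<open>SB\<close> has to be compared with \<open>SA\<close>.\<close>
  have "l * SB \<le> (\<Sum>v\<in>B. SA + (\<Sum>w\<in>B. adj F v w * y w))"
    unfolding SB_def sum_distrib_left by (intro sum_mono hB')
  hence "l * SB \<le> card B * SA + YB" by (simp add: sum.distrib inner YB_def)
  with YB have "l * SB \<le> SA * (card B + RB / l)" by (simp add: distrib_left mult.commute)
  hence SB: "SB \<le> SA * ((card B + RB / l) / l)" using l0 by (simp add: pos_le_divide_eq mult.commute)
  have "l * SA \<le> (\<Sum>u\<in>A. (\<Sum>v\<in>B. adj E u v * y v) + (\<Sum>w\<in>A. adj F u w * y w))"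
    unfolding SA_def sum_distrib_left by (intro sum_mono hA)
  hence "l * SA \<le> (\<Sum>u\<in>A. \<Sum>v\<in>B. adj E u v * y v) + YA" by (simp add: sum.distrib inner YA_def)
  hence "l * (l * SA) \<le> l * ((\<Sum>u\<in>A. \<Sum>v\<in>B. adj E u v * y v) + YA)" using l0 by simp
  also have "\<dots> = (\<Sum>u\<in>A. \<Sum>v\<in>B. adj E u v * (l * y v)) + l * YA"
    by (simp add: distrib_left sum_distrib_left mult_ac)
  \<comment> \<open>Only the main term \<open>SA\<close> keeps the factor \<open>adj E u v\<close>,
    so that missing cross edges are felt; in the lower-order term it is replaced by 1.\<close>
  also have "(\<Sum>u\<in>A. \<Sum>v\<in>B. adj E u v * (l * y v)) \<le>
      (\<Sum>u\<in>A. \<Sum>v\<in>B. adj E u v * SA + (\<Sum>w\<in>B. adj F v w * y w))"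
  proof (intro sum_mono)
    fix u v assume "v \<in> B"
    moreover have "0 \<le> (\<Sum>w\<in>B. adj F v w * y w)" using y by (intro sum_nonneg mult_nonneg_nonneg) auto
    ultimately show "adj E u v * (l * y v) \<le> adj E u v * SA + (\<Sum>w\<in>B. adj F v w * y w)"
      using hB'[of v] by (auto simp: adj_def)
  qed
  also have "\<dots> = e * SA + card A * YB"
    by (simp add: sum.distrib e_def sum_distrib_right inner YB_def)
  finally have "l * (l * SA) \<le> e * SA + card A * YB + l * YA" by simp
  also have "\<dots> \<le> e * SA + card A * (SA * RB / l) + SB * RA"
    using YA mult_left_mono[OF YB, of "real (card A)"] by linarith
  also have "\<dots> \<le> e * SA + card A * (SA * RB / l) + SA * ((card B + RB / l) / l) * RA"
    using R0 by (intro add_left_mono mult_right_mono SB) auto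
  also have "\<dots> = SA * (e + (card A * RB + card B * RA) / l + RA * RB / l\<^sup>2)"
    using l0 by (simp add: field_simps power2_eq_square)
  finally have "SA * l\<^sup>2 \<le> SA * (e + (card A * RB + card B * RA) / l + RA * RB / l\<^sup>2)"
    by (simp add: power2_eq_square mult_ac)
  hence "l\<^sup>2 \<le> e + (card A * RB + card B * RA) / l + RA * RB / l\<^sup>2" using SA by (simp add: mult_le_cancel_left)
  thus ?thesis by (simp add: e_def RA_def RB_def)
qed

section \<open>Walk counts and the shape of the inner edges\<close>

text \<open>Both sides count the triples of a vertex and two edges through it. In this form
  \<open>w2\<close> is visibly an integer, and largest when the edges meet pairwise.\<close>

lemma sum_degree_squares:
  assumes sg: "simple_graph (V, F)"
  shows "w2 V F = real (\<Sum>e\<in>F. \<Sum>e'\<in>F. card (e \<inter> e'))"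
proof -
  note S = simple_graphD[OF sg]
  have "w2 V F = (\<Sum>u\<in>V. (\<Sum>e\<in>F. if u \<in> e then 1 else 0)\<^sup>2)"
    unfolding w2_def deg_def degree_eq_incident_edges[OF sg]
    using S(2) by (intro sum.cong refl) (simp add: sum.If_cases Int_def)
  also have "\<dots> = (\<Sum>u\<in>V. \<Sum>e\<in>F. \<Sum>e'\<in>F. if u \<in> e \<inter> e' then 1 else 0)"
    unfolding power2_eq_square sum_product by (intro sum.cong refl) auto
  also have "\<dots> = (\<Sum>e\<in>F. \<Sum>u\<in>V. \<Sum>e'\<in>F. if u \<in> e \<inter> e' then 1 else 0)" by (rule sum.swap)
  also have "\<dots> = (\<Sum>e\<in>F. \<Sum>e'\<in>F. \<Sum>u\<in>V. if u \<in> e \<inter> e' then 1 else 0)"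
    by (intro sum.cong refl sum.swap)
  also have "\<dots> = (\<Sum>e\<in>F. \<Sum>e'\<in>F. real (card (e \<inter> e')))"
  proof (intro sum.cong refl)
    fix e e' assume "e \<in> F" "e' \<in> F"
    hence "V \<inter> {u. u \<in> e \<inter> e'} = e \<inter> e'" using S(3) by blast
    thus "(\<Sum>u\<in>V. if u \<in> e \<inter> e' then 1 else 0) = real (card (e \<inter> e'))"
      using S(1) by (simp add: sum.If_cases del: Int_iff)
  qed
  finally show ?thesis by simp
qed

lemma card_Int_edges_le:
  assumes "card e = 2" "card e' = 2"
  shows "card (e \<inter> e') \<le> (if e = e' then 2 else 1)"
proof (cases "e = e'")
  case False
  have fin: "finite e" "finite e'" using assms by (metis card.infinite zero_neq_numeral)+
  have "\<not> 2 \<le> card (e \<inter> e')"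
  proof
    assume *: "2 \<le> card (e \<inter> e')"
    have "e \<inter> e' = e" using * assms fin by (intro card_seteq) auto
    moreover have "e \<inter> e' = e'" using * assms fin by (intro card_seteq) auto
    ultimately show False using False by simp
  qed
  with False show ?thesis by simp
qed (use assms in auto)

text \<open>In the sum over ordered pairs of edges each diagonal pair contributes 2 and every other
  pair at most 1; a disjoint pair contributes 0.\<close>

lemma w2_le:
  assumes sg: "simple_graph (V, F)"
  shows "w2 V F \<le> real (card F * card F + card F)"
    and "e1 \<in> F \<Longrightarrow> e2 \<in> F \<Longrightarrow> e1 \<inter> e2 = {} \<Longrightarrow> w2 V F < real (card F * card F + card F)"
proof -
  note S = simple_graphD[OF sg]
  let ?c = "\<lambda>e e'. if e = e' then 2 else 1 :: nat"
  have c: "card (e \<inter> e') \<le> ?c e e'" if "e \<in> F" "e' \<in> F" for e e'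
    using card_Int_edges_le S(4) that by blast
  have row: "(\<Sum>e'\<in>F. ?c e e') = card F + 1" if "e \<in> F" for e
  proof -
    have "(\<Sum>e'\<in>F. ?c e e') = (\<Sum>e'\<in>F. 1 + (if e' = e then 1 else 0))" by (intro sum.cong) auto
    also have "\<dots> = card F + 1" unfolding sum.distrib using S(2) that by simp
    finally show ?thesis .
  qed
  have tot: "(\<Sum>e\<in>F. \<Sum>e'\<in>F. ?c e e') = card F * card F + card F" by (simp add: row)
  have "(\<Sum>e\<in>F. \<Sum>e'\<in>F. card (e \<inter> e')) \<le> (\<Sum>e\<in>F. \<Sum>e'\<in>F. ?c e e')"
    by (intro sum_mono c)
  thus "w2 V F \<le> real (card F * card F + card F)"
    unfolding sum_degree_squares[OF sg] tot by (rule of_nat_mono)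
  assume e: "e1 \<in> F" "e2 \<in> F" "e1 \<inter> e2 = {}"
  have "(\<Sum>e'\<in>F. card (e1 \<inter> e')) < (\<Sum>e'\<in>F. ?c e1 e')"
    using e S(2) c by (intro sum_strict_mono_ex1) (auto intro!: bexI[of _ e2])
  hence "(\<Sum>e\<in>F. \<Sum>e'\<in>F. card (e \<inter> e')) < (\<Sum>e\<in>F. \<Sum>e'\<in>F. ?c e e')"
    using e S(2) c by (intro sum_strict_mono_ex1) (auto intro!: sum_mono)
  thus "w2 V F < real (card F * card F + card F)"
    unfolding sum_degree_squares[OF sg] tot by (rule iffD2[OF of_nat_less_iff])
qed

lemma w1_eq: "simple_graph (V, F) \<Longrightarrow> w1 V F = 2 * real (card F)"
  by (simp add: w1_def deg_def handshake)

lemma deg_le_card: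
  assumes "simple_graph (V, F)"
  shows "deg V F u \<le> card F"
  unfolding deg_def degree_eq_incident_edges[OF assms]
  using simple_graphD(2)[OF assms] by (simp add: card_mono)

text \<open>A walk of length three has one of \<open>2 * card F\<close> oriented middle edges, and
  \<open>c\<close> bounds the number of extensions of each.\<close>

lemma w3_le:
  assumes sg: "simple_graph (V, F)" and c: "\<And>u v. {u, v} \<in> F \<Longrightarrow> deg V F u * deg V F v \<le> c"
  shows "w3 V F \<le> 2 * real (card F) * c"
proof -
  have "w3 V F \<le> (\<Sum>u\<in>V. \<Sum>v\<in>V. adj F u v * c)"
    unfolding w3_def by (intro sum_mono) (auto simp: adj_def intro: c)
  also have "\<dots> = 2 * real (card F) * c" by (simp add: sum_distrib_right[symmetric] handshake[OF sg])
  finally show ?thesis .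
qed

lemma deg_part:
  assumes sg: "simple_graph (V, F)" and "A \<union> B = V" "A \<inter> B = {}"
    and inner: "\<forall>e\<in>F. e \<subseteq> A \<or> e \<subseteq> B" and u: "u \<in> A"
  shows "deg A F u = deg V F u"
  unfolding deg_def
proof (rule sum.mono_neutral_left)
  show "\<forall>v\<in>V - A. adj F u v = 0"
  proof
    fix v assume "v \<in> V - A"
    thus "adj F u v = 0" using inner[rule_format, of "{u, v}"] u assms(2,3) by (auto simp: adj_def)
  qed
qed (use simple_graphD(1)[OF sg] assms(2) in auto)

text \<open>A walk along inner edges never leaves the part in which it starts.\<close>

lemma w_split:
  assumes sg: "simple_graph (V, F)" and AB: "A \<union> B = V" "A \<inter> B = {}"
    and inner: "\<forall>e\<in>F. e \<subseteq> A \<or> e \<subseteq> B"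
  shows "w1 A F + w1 B F = w1 V F" "w2 A F + w2 B F = w2 V F" "w3 A F + w3 B F = w3 V F"
proof -
  have fin: "finite A" "finite B" using simple_graphD(1)[OF sg] AB(1) by auto
  have BA: "B \<union> A = V" "B \<inter> A = {}" and inner': "\<forall>e\<in>F. e \<subseteq> B \<or> e \<subseteq> A"
    using AB inner by auto
  note dA = deg_part[OF sg AB inner] and dB = deg_part[OF sg BA inner']
  have un: "sum g V = sum g A + sum g B" for g :: "'a \<Rightarrow> real"
    using sum.union_disjoint[OF fin AB(2), of g] AB(1) by simp
  have z: "adj F u v = 0" if "u \<in> A \<and> v \<in> B \<or> u \<in> B \<and> v \<in> A" for u v
    using inner[rule_format, of "{u, v}"] that AB(2) by (auto simp: adj_def)
  show "w1 A F + w1 B F = w1 V F" "w2 A F + w2 B F = w2 V F" "w3 A F + w3 B F = w3 V F"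
    by (simp_all add: w1_def w2_def w3_def un dA dB z)
qed

text \<open>Without a common vertex, an edge \<open>{a, b}\<close>, an edge avoiding
  \<open>a\<close> and an edge avoiding \<open>b\<close> close up to a triangle, and a pair that
  meets all three sides of a triangle is itself a side.\<close>

lemma intersecting_edges_star_or_triangle:
  assumes c2: "\<And>e. e \<in> F \<Longrightarrow> card e = 2" and ne: "F \<noteq> {}"
    and int: "\<And>e e'. e \<in> F \<Longrightarrow> e' \<in> F \<Longrightarrow> e \<inter> e' \<noteq> {}"
  shows "(\<exists>c. \<forall>e\<in>F. c \<in> e) \<or>
    (\<exists>a b c. a \<noteq> b \<and> b \<noteq> c \<and> a \<noteq> c \<and> F = {{a, b}, {b, c}, {a, c}})"
proof (rule disjCI)
  assume tri: "\<not> (\<exists>a b c. a \<noteq> b \<and> b \<noteq> c \<and> a \<noteq> c \<and> F = {{a, b}, {b, c}, {a, c}})"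
  show "\<exists>c. \<forall>e\<in>F. c \<in> e"
  proof (rule ccontr)
    assume nostar: "\<not> ?thesis"
    obtain e where "e \<in> F" using ne by blast
    moreover from this obtain a b where ab: "e = {a, b}" "a \<noteq> b" using c2 by (metis card_2_iff)
    ultimately have 1: "{a, b} \<in> F" by simp
    obtain e' where e': "e' \<in> F" "a \<notin> e'" using nostar by blast
    moreover from e' c2 obtain x y where "e' = {x, y}" "x \<noteq> y" by (metis card_2_iff)
    moreover have "b \<in> e'" using int[OF 1 e'(1)] e'(2) by auto
    ultimately obtain c where c: "e' = {b, c}" "c \<noteq> b" by (metis doubleton_eq_iff insertE singletonD)
    have ca: "a \<noteq> c" using c e' by auto
    obtain e'' where e'': "e'' \<in> F" "b \<notin> e''" using nostar by blast
    have "a \<in> e''" using int[OF 1 e''(1)] e''(2) by auto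
    moreover have "c \<in> e''" using int[OF e'(1) e''(1)] e''(2) c by auto
    moreover obtain x y where "e'' = {x, y}" using c2[OF e''(1)] by (metis card_2_iff)
    ultimately have e3: "e'' = {a, c}" using ca by auto
    have "g \<in> {{a, b}, {b, c}, {a, c}}" if g: "g \<in> F" for g
    proof -
      obtain x y where xy: "g = {x, y}" using c2[OF g] by (metis card_2_iff)
      have "g \<inter> {a, b} \<noteq> {}" "g \<inter> {b, c} \<noteq> {}" "g \<inter> {a, c} \<noteq> {}"
        using int[OF g 1] int[OF g e'(1)] int[OF g e''(1)] c e3 by auto
      thus ?thesis using xy ab(2) c(2) ca by (auto simp: doubleton_eq_iff)
    qed
    hence "F = {{a, b}, {b, c}, {a, c}}" using 1 e'(1) e''(1) c e3 by auto
    thus False using tri ab(2) c(2) ca by blast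
  qed
qed

text \<open>Every edge joins the centre, of degree at most \<open>card F\<close>, to a leaf of
  degree at most one.\<close>

lemma star_deg_product:
  assumes sg: "simple_graph (V, F)" and star: "\<And>e. e \<in> F \<Longrightarrow> c \<in> e" and uv: "{u, v} \<in> F"
  shows "deg V F u * deg V F v \<le> card F"
proof -
  note S = simple_graphD[OF sg]
  have leaf: "deg V F x \<le> 1" if x: "x \<noteq> c" for x
  proof -
    have "{e\<in>F. x \<in> e} \<subseteq> {{x, c}}"
    proof
      fix e assume e: "e \<in> {e\<in>F. x \<in> e}"
      hence "card e = 2" using S(4) by blast
      then obtain a b where "e = {a, b}" by (auto simp: card_2_iff)
      thus "e \<in> {{x, c}}" using e star[of e] x by auto
    qed
    from card_mono[OF _ this] show ?thesis unfolding deg_def degree_eq_incident_edges[OF sg] by simp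
  qed
  have "u \<noteq> v" using S(5)[OF uv] by blast
  hence "(u \<noteq> c \<and> v = c) \<or> (u = c \<and> v \<noteq> c)" using star[OF uv] by auto
  thus ?thesis
  proof
    assume "u \<noteq> c \<and> v = c"
    hence "deg V F u * deg V F v \<le> 1 * real (card F)" by (intro mult_mono deg_le_card[OF sg] leaf) auto
    thus ?thesis by simp
  next
    assume "u = c \<and> v \<noteq> c"
    hence "deg V F u * deg V F v \<le> real (card F) * 1" by (intro mult_mono deg_le_card[OF sg] leaf) auto
    thus ?thesis by simp
  qed
qed

subsection \<open>Comparison with the optimal embedding\<close>

text \<open>\<open>p\<close>, \<open>q\<close>, \<open>m\<close> belong to the candidate graph;
  \<open>a\<close>, \<open>b\<close>, \<open>e\<close>, \<open>f\<close> stand for part sizes, cross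
  edges and inner edges of the graph compared with it. As \<open>a / l\<close> and
  \<open>b / l\<close> are at most \<open>1 + c / l\<close>, the constant terms of the two estimates
  of \<open>l^2\<close> are \<open>p * q + 2 * m\<close> and \<open>e + 2 * f\<close>. The remainder
  of order \<open>1 / l\<close> will be below one for large graphs.\<close>

lemma first_order_bound:
  fixes a b c e f m p q l K RA RB :: real
  assumes l: "1 \<le> l" "l \<le> q + 1" and nn: "0 \<le> m" "0 \<le> c" "0 \<le> K" "0 \<le> RA" "0 \<le> RB"
    and ab: "a \<le> l + c" "b \<le> l + c" and R: "RA + RB \<le> 2 * f + K / l" and f: "f \<le> m"
    and lo: "q * (p + 2 * m / l) \<le> l\<^sup>2" and up: "l\<^sup>2 \<le> e + (a * RB + b * RA) / l + RA * RB / l\<^sup>2"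
  shows "p * q + 2 * m \<le> e + 2 * f + (2 * m + K + c * (2 * m + K) + (2 * m + K)\<^sup>2) / l"
proof -
  define M where "M = 2 * m + K"
  have "K / l \<le> K" using l nn by (simp add: divide_le_eq mult_le_cancel_left1)
  hence RM: "RA + RB \<le> M" using R f by (simp add: M_def)
  have M0: "0 \<le> M" using nn by (simp add: M_def)
  have "l * 1 \<le> l * l" using l by (intro mult_left_mono) auto
  hence ll: "l \<le> l\<^sup>2" by (simp add: power2_eq_square)
  have "RA * RB \<le> M\<^sup>2"
    unfolding power2_eq_square using RM nn M0 by (intro mult_mono) auto
  hence 1: "RA * RB / l\<^sup>2 \<le> M\<^sup>2 / l" using l ll nn by (intro frac_le) auto
  have "a * RB + b * RA \<le> (l + c) * RB + (l + c) * RA"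
    using ab nn by (intro add_mono mult_right_mono) auto
  also have "\<dots> = l * (RA + RB) + c * (RA + RB)" by (simp add: algebra_simps)
  finally have 0: "a * RB + b * RA \<le> l * (RA + RB) + c * (RA + RB)" .
  have "l * (RA + RB) \<le> l * (2 * f + K / l)" by (rule mult_left_mono[OF R]) (use l in simp)
  moreover have "c * (RA + RB) \<le> c * M" by (rule mult_left_mono[OF RM nn(2)])
  ultimately have "a * RB + b * RA \<le> l * (2 * f + K / l) + c * M" using 0 by linarith
  hence "(a * RB + b * RA) / l \<le> (l * (2 * f + K / l) + c * M) / l"
    using l by (intro divide_right_mono) auto
  also have "\<dots> = 2 * f + K / l + c * M / l" using l by (simp add: add_divide_distrib)
  finally have 2: "(a * RB + b * RA) / l \<le> 2 * f + K / l + c * M / l" .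
  \<comment> \<open>Since \<open>q \<ge> l - 1\<close>, replacing \<open>q / l\<close> by 1 costs at
    most \<open>2 * m / l\<close>.\<close>
  have "2 * m * (l - 1) / l \<le> 2 * m * q / l"
    using l nn by (intro divide_right_mono mult_left_mono) auto
  moreover have "2 * m * (l - 1) / l = 2 * m - 2 * m / l" using l by (simp add: field_simps)
  moreover have "q * (p + 2 * m / l) = p * q + 2 * m * q / l" by (simp add: algebra_simps)
  ultimately have 3: "p * q + 2 * m - 2 * m / l \<le> l\<^sup>2" using lo by linarith
  have "(2 * m + K + c * M + M\<^sup>2) / l = 2 * m / l + K / l + c * M / l + M\<^sup>2 / l"
    by (simp add: add_divide_distrib)
  with 1 2 3 up show ?thesis unfolding M_def by linarith
qed

text \<open>With all cross edges present and \<open>m\<close> inner edges, the terms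
  \<open>p * q\<close> and \<open>2 * m * l * q\<close> cancel after multiplication by
  \<open>l^2\<close>. What remains compares the counts of walks of length two,
  \<open>m^2 + m\<close> for the candidate and \<open>v\<close> for the other graph, with an error
  not growing with \<open>q\<close>.\<close>

lemma second_order_bound:
  fixes a b m p q l M s RA RB :: real
  assumes l: "1 \<le> l" "2 * m + 1 \<le> l" "q \<le> l + 1" and nn: "0 \<le> m" "0 \<le> q" "0 \<le> RA" "0 \<le> RB" "0 \<le> s"
    and ab: "a \<le> q" "b \<le> q" and R: "RA + RB = 2 * m + v / l + s / (l * (l - m))" "RA + RB \<le> M"
    and lo: "q * (p + 2 * m / l + (m\<^sup>2 + m) / l\<^sup>2) \<le> l\<^sup>2"
    and up: "l\<^sup>2 \<le> p * q + (a * RB + b * RA) / l + RA * RB / l\<^sup>2"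
  shows "q * (m\<^sup>2 + m) \<le> q * v + (2 * s + M\<^sup>2)"
proof -
  have lm: "l - m > 0" using l nn by linarith
  have "RA * RB \<le> M\<^sup>2"
    unfolding power2_eq_square using R nn by (intro mult_mono) auto
  moreover have "l * (a * RB + b * RA) \<le> q * (2 * m * l + v + s / (l - m))"
  proof -
    have "a * RB \<le> q * RB" "b * RA \<le> q * RA" using ab nn by (auto intro: mult_right_mono)
    hence "a * RB + b * RA \<le> q * (RA + RB)" by (simp add: distrib_left)
    hence "l * (a * RB + b * RA) \<le> l * (q * (RA + RB))" using l by (intro mult_left_mono) auto
    also have "\<dots> = q * (l * (RA + RB))" by (rule mult.left_commute)
    also have "l * (RA + RB) = 2 * m * l + v + s / (l - m)"
      unfolding R(1) using l lm by (simp add: distrib_left)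
    finally show ?thesis .
  qed
  moreover have "q * (2 * m / l + (m\<^sup>2 + m) / l\<^sup>2) \<le> (a * RB + b * RA) / l + RA * RB / l\<^sup>2"
    using lo up by (simp add: algebra_simps)
  hence "l\<^sup>2 * (q * (2 * m / l + (m\<^sup>2 + m) / l\<^sup>2)) \<le> l\<^sup>2 * ((a * RB + b * RA) / l + RA * RB / l\<^sup>2)"
    by (intro mult_left_mono) auto
  moreover have "l\<^sup>2 * (q * (2 * m / l + (m\<^sup>2 + m) / l\<^sup>2)) = q * (2 * m * l + (m\<^sup>2 + m))"
    using l by (simp add: field_simps power2_eq_square)
  moreover have "l\<^sup>2 * ((a * RB + b * RA) / l + RA * RB / l\<^sup>2) = l * (a * RB + b * RA) + RA * RB"
    using l by (simp add: field_simps power2_eq_square)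
  ultimately have "q * (2 * m * l + (m\<^sup>2 + m)) \<le> q * (2 * m * l + v + s / (l - m)) + M\<^sup>2" by linarith
  hence "q * (m\<^sup>2 + m) \<le> q * v + q * (s / (l - m)) + M\<^sup>2" by (simp add: algebra_simps)
  moreover have "q * (s / (l - m)) \<le> 2 * s"
  proof -
    \<comment> \<open>\<open>q \<le> 2 * (l - m)\<close> follows from \<open>q \<le> l + 1\<close>
      and \<open>2 * m + 1 \<le> l\<close>.\<close>
    have "q * s \<le> (2 * (l - m)) * s" using l nn by (intro mult_right_mono) auto
    thus ?thesis using lm by (simp add: divide_le_eq mult_ac)
  qed
  ultimately show ?thesis by linarith
qed

text \<open>With all inner edges in one part, the gain of the other part is zero and the product
  term disappears, so the comparison reaches the next order. There \<open>s\<close> comes from the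
  walks of length three and \<open>t\<close> is what the candidate offers; \<open>b\<close> is the
  size of the part without inner edges.\<close>

lemma one_sided_bound:
  fixes b m p q l s t RA :: real
  assumes l: "1 \<le> l" "m < l"
    and R: "RA = 2 * m + (m\<^sup>2 + m) / l + s / (l * (l - m))"
    and lo: "q * (p + 2 * m / l + (m\<^sup>2 + m) / l\<^sup>2 + t / l ^ 3) \<le> l\<^sup>2"
    and up: "l\<^sup>2 \<le> p * q + b * RA / l"
  shows "q * (2 * m * l + (m\<^sup>2 + m) + t / l) \<le> b * (2 * m * l + (m\<^sup>2 + m) + s / (l - m))"
proof -
  have "q * (2 * m / l + (m\<^sup>2 + m) / l\<^sup>2 + t / l ^ 3) \<le> b * RA / l"
    using lo up by (simp add: algebra_simps)
  hence "l\<^sup>2 * (q * (2 * m / l + (m\<^sup>2 + m) / l\<^sup>2 + t / l ^ 3)) \<le> l\<^sup>2 * (b * RA / l)"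
    by (intro mult_left_mono) auto
  moreover have "l\<^sup>2 * (q * (2 * m / l + (m\<^sup>2 + m) / l\<^sup>2 + t / l ^ 3)) = q * (2 * m * l + (m\<^sup>2 + m) + t / l)"
    using l by (simp add: field_simps power2_eq_square power3_eq_cube)
  moreover have "l * RA = 2 * m * l + (m\<^sup>2 + m) + s / (l - m)"
  proof -
    have "l * RA = l * (2 * m) + l * ((m\<^sup>2 + m) / l) + l * (s / (l * (l - m)))"
      unfolding R by (simp only: distrib_left)
    moreover have "l * ((m\<^sup>2 + m) / l) = m\<^sup>2 + m" "l * (s / (l * (l - m))) = s / (l - m)"
      using l by simp_all
    ultimately show ?thesis by simp
  qed
  hence "l\<^sup>2 * (b * RA / l) = b * (2 * m * l + (m\<^sup>2 + m) + s / (l - m))"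
    using l by (simp add: power2_eq_square mult.left_commute)
  ultimately show ?thesis by simp
qed

section \<open>Eigenvalues of the candidate graph\<close>

text \<open>The intermediate value theorem for \<open>x^2 - q * (p + g x)\<close>, which is at most
  0 at \<open>p\<close> and at least 0 at \<open>q + 1\<close>. In the applications
  \<open>p + g l\<close> is the sum of the eigenvector over the embedded part.\<close>

lemma equation_root:
  fixes g :: "real \<Rightarrow> real"
  assumes pq: "0 \<le> p" "p \<le> q" and cont: "continuous_on {p..q + 1} g"
    and g: "\<And>x. p \<le> x \<Longrightarrow> x \<le> q + 1 \<Longrightarrow> 0 \<le> g x \<and> g x \<le> 1"
  obtains l where "p \<le> l" "l \<le> q + 1" "l\<^sup>2 = q * (p + g l)"
proof -
  let ?h = "\<lambda>x. x\<^sup>2 - q * (p + g x)"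
  have "p * p \<le> q * (p + g p)" using pq g[of p] by (intro mult_mono) auto
  hence 1: "?h p \<le> 0" by (simp add: power2_eq_square)
  have "q * (p + g (q + 1)) \<le> q * (q + 1)" using pq g[of "q + 1"] by (intro mult_left_mono) auto
  also have "\<dots> \<le> (q + 1) * (q + 1)" using pq by (intro mult_right_mono) auto
  finally have 2: "0 \<le> ?h (q + 1)" by (simp add: power2_eq_square)
  have "continuous_on {p..q + 1} ?h" by (intro continuous_intros cont)
  from IVT'[of ?h p 0 "q + 1", OF 1 2 _ this] pq
  obtain l where "p \<le> l" "l \<le> q + 1" "?h l = 0" by auto
  thus ?thesis using that by simp
qed

text \<open>An eigenvector of the bipartite graph with \<open>F\<close> embedded in the first part, normalised to \<open>l / q\<close>
  on the other part of size \<open>q\<close>, satisfies \<open>(l - F) z = l\<close> on the first part.\<close>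

definition embedding_solution :: "nat \<Rightarrow> nat set set \<Rightarrow> real \<Rightarrow> (nat \<Rightarrow> real) \<Rightarrow> bool" where
  "embedding_solution p F l z \<longleftrightarrow> (\<forall>u<p. l * z u = (\<Sum>v<p. adj F u v * z v) + l)"

text \<open>By symmetry the solution takes three values: \<open>1 + c0\<close> at the centre,
  \<open>1 + c1\<close> at the leaves and 1 elsewhere.\<close>

lemma star_solution:
  assumes p: "m < p" and l: "l\<^sup>2 > real m"
  defines "F \<equiv> (\<lambda>i. {0, i}) ` {1..m}"
  shows "\<exists>z. embedding_solution p F l z \<and>
    (\<Sum>v<p. z v) = p + (2 * real m * l + m + (real m)\<^sup>2) / (l\<^sup>2 - m)"
proof -
  define D where "D = l\<^sup>2 - m"
  have D: "D > 0" using l by (simp add: D_def)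
  \<comment> \<open>\<open>c0\<close> and \<open>c1\<close> solve \<open>l * c0 = m + m * c1\<close>
    and \<open>l * c1 = 1 + c0\<close>, a linear system with determinant \<open>D\<close>.\<close>
  define c0 where "c0 = (m * l + m) / D"
  define c1 where "c1 = (l + m) / D"
  define z where "z v = 1 + (if v = 0 then c0 else 0) + (if v \<in> {1..m} then c1 else 0)" for v :: nat
  have c0: "l * c0 = m + m * c1"
    using D by (simp add: c0_def c1_def field_simps) (simp add: D_def power2_eq_square algebra_simps)
  have c1: "l * c1 = 1 + c0"
    using D by (simp add: c0_def c1_def field_simps) (simp add: D_def power2_eq_square algebra_simps)
  have ind: "(\<Sum>v<p. if v \<in> {1..m} then c else 0) = m * c" for c :: real
  proof -
    have "(\<Sum>v<p. if v \<in> {1..m} then c else 0) = (\<Sum>v\<in>{1..m}. c)"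
      by (intro sum.mono_neutral_cong_right) (use p in auto)
    thus ?thesis by simp
  qed
  have sumz: "(\<Sum>v<p. z v) = p + c0 + m * c1"
    unfolding z_def sum.distrib ind using p by simp
  have adj0: "adj F 0 v = (if v \<in> {1..m} then 1 else 0)" for v
    by (auto simp: adj_def F_def doubleton_eq_iff)
  have adj1: "adj F u v = (if v = 0 \<and> u \<in> {1..m} then 1 else 0)" if "u \<noteq> 0" for u v :: nat
    using that by (auto simp: adj_def F_def doubleton_eq_iff)
  have "l * z u = (\<Sum>v<p. adj F u v * z v) + l" if u: "u < p" for u
  proof (cases "u = 0")
    case True
    have "(\<Sum>v<p. adj F 0 v * z v) = (\<Sum>v<p. if v \<in> {1..m} then 1 + c1 else 0)"
      by (intro sum.cong refl) (auto simp: adj0 z_def)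
    also have "\<dots> = m * (1 + c1)" by (rule ind)
    finally show ?thesis using True c0 by (simp add: z_def algebra_simps)
  next
    case False
    have "(\<Sum>v<p. adj F u v * z v) = (\<Sum>v<p. if v = 0 then (if u \<in> {1..m} then 1 + c0 else 0) else 0)"
      using False by (intro sum.cong refl) (auto simp: adj1 z_def)
    also have "\<dots> = (if u \<in> {1..m} then 1 + c0 else 0)" using p by simp
    finally show ?thesis using False c1 by (auto simp: z_def algebra_simps)
  qed
  moreover have "c0 + m * c1 = (2 * real m * l + m + (real m)\<^sup>2) / D"
    by (simp add: c0_def c1_def add_divide_distrib power2_eq_square algebra_simps)
  ultimately show ?thesis using sumz unfolding embedding_solution_def D_def by (intro exI[of _ z]) auto
qed

text \<open>The solution is \<open>1 + c\<close> on the triangle and 1 elsewhere, where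
  \<open>l * c = 2 * (1 + c)\<close>.\<close>

lemma triangle_solution:
  assumes p: "3 \<le> p" and l: "l > 2"
  shows "\<exists>z. embedding_solution p {{0, 1}, {1, 2}, {0, 2}} l z \<and> (\<Sum>v<p. z v) = p + 6 / (l - 2)"
proof -
  define F where "F = {{0, 1}, {1, 2}, {0, 2 :: nat}}"
  define c where "c = 2 / (l - 2)"
  define z where "z v = 1 + (if v < 3 then c else 0)" for v :: nat
  have c: "l * c = 2 + 2 * c" using l by (simp add: c_def field_simps)
  have int: "{..<p} \<inter> {v. v < 3} = {..<3}" using p by auto
  have sumz: "(\<Sum>v<p. z v) = p + 3 * c"
    unfolding z_def sum.distrib by (simp add: sum.If_cases int)
  have adj: "adj F u v = (if u < 3 \<and> v < 3 \<and> u \<noteq> v then 1 else 0)" for u v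
    by (auto simp: adj_def F_def doubleton_eq_iff)
  have "l * z u = (\<Sum>v<p. adj F u v * z v) + l" if u: "u < p" for u
  proof (cases "u < 3")
    case True
    have "(\<Sum>v<p. adj F u v * z v) = (\<Sum>v\<in>{..<3} - {u}. 1 + c)"
      using p by (intro sum.mono_neutral_cong_right) (auto simp: adj z_def True)
    also have "\<dots> = 2 * (1 + c)" using True by simp
    finally show ?thesis using True c by (simp add: z_def algebra_simps)
  qed (simp add: adj z_def)
  moreover have "3 * c = 6 / (l - 2)" by (simp add: c_def)
  ultimately show ?thesis using sumz unfolding embedding_solution_def F_def[symmetric] by (intro exI[of _ z]) auto
qed

lemma card_star: "card ((\<lambda>i. {0, i}) ` {1..m::nat}) = m"
  by (subst card_image) (auto simp: inj_on_def doubleton_eq_iff)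

text \<open>The candidate is a triangle for \<open>m = 3\<close> and a star otherwise. Expanding the
  sum of \<open>z\<close> in powers of \<open>1 / l\<close> gives the walk counts
  \<open>2 * m\<close> and \<open>m^2 + m\<close> as coefficients, and for the triangle also its 24
  walks of length three. For the star the higher terms are dropped, which only weakens the lower
  bound.\<close>

lemma optimal_embedding:
  fixes m p q :: nat
  assumes m: "1 \<le> m" and p: "3 * m + 8 \<le> p" and q: "p \<le> q"
  obtains F :: "nat set set" and l :: real and z :: "nat \<Rightarrow> real"
  where "simple_graph ({..<p}, F)" "card F = m" "embedding_solution p F l z"
    "l\<^sup>2 = q * (\<Sum>v<p. z v)" "real p \<le> l" "l \<le> real q + 1"
    "p + 2 * real m / l + ((real m)\<^sup>2 + m) / l\<^sup>2 + (if m = 3 then 24 else 0) / l ^ 3 \<le> (\<Sum>v<p. z v)"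
proof (cases "m = 3")
  case True
  have g: "0 \<le> 6 / (x - 2) \<and> 6 / (x - 2) \<le> 1" if "real p \<le> x" for x :: real
    using p that by (simp add: divide_le_eq)
  have "continuous_on {real p..real q + 1} (\<lambda>x. 6 / (x - 2))"
    using p by (intro continuous_intros) auto
  from equation_root[OF _ _ this] g q
  obtain l where l: "real p \<le> l" "l \<le> real q + 1" "l\<^sup>2 = q * (real p + 6 / (l - 2))" by auto
  have l8: "l \<ge> 8" using l p by simp
  obtain z where z: "embedding_solution p {{0, 1}, {1, 2}, {0, 2}} l z" "(\<Sum>v<p. z v) = p + 6 / (l - 2)"
    using triangle_solution[of p l, OF le_trans[OF _ p]] l8 by fastforce
  \<comment> \<open>These are the first three terms of the geometric series for
    \<open>6 / (l - 2)\<close>; the remainder is \<open>48 / (l^3 * (l - 2))\<close>.\<close>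
  have "6 / l + 12 / l\<^sup>2 + 24 / l ^ 3 = (6 * l ^ 3 - 48) / (l ^ 3 * (l - 2))"
    using l8 by (simp add: field_simps power2_eq_square power3_eq_cube)
  also have "\<dots> \<le> (6 * l ^ 3) / (l ^ 3 * (l - 2))" using l8 by (intro divide_right_mono) auto
  also have "\<dots> = 6 / (l - 2)" using l8 by simp
  finally have "p + 2 * real m / l + ((real m)\<^sup>2 + m) / l\<^sup>2 + (if m = 3 then 24 else 0) / l ^ 3 \<le> (\<Sum>v<p. z v)"
    using True z(2) by simp
  moreover have "simple_graph ({..<p}, {{0, 1}, {1, 2}, {0, 2}})"
    using p by (auto simp: simple_graph_def)
  moreover have "card {{0, 1}, {1, 2}, {0, 2 :: nat}} = m" using True by (simp add: card_insert_if doubleton_eq_iff)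
  ultimately show ?thesis using that[of _ l z] z l by simp
next
  case False
  let ?g = "\<lambda>x :: real. (2 * real m * x + m + (real m)\<^sup>2) / (x\<^sup>2 - m)"
  \<comment> \<open>Positivity makes \<open>?g\<close> continuous, and the comparison with the
    numerator gives the bound \<open>?g x \<le> 1\<close> that \<open>equation_root\<close> asks
    for.\<close>
  have big: "x\<^sup>2 - m \<ge> 2 * m * x + m + (real m)\<^sup>2 \<and> x\<^sup>2 - m > 0" if "real p \<le> x" for x :: real
  proof -
    have x: "x \<ge> 3 * real m + 8" using p that by linarith
    have "x * x \<ge> (3 * real m + 8) * x" using x by (intro mult_right_mono) auto
    moreover have "(real m + 8) * x \<ge> (real m + 8) * (3 * real m + 8)" using x by (intro mult_left_mono) auto
    moreover have "0 \<le> real m * real m" "0 \<le> real m * x" using x by simp_all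
    moreover have "real m \<ge> 1" using m by simp
    ultimately show ?thesis unfolding power2_eq_square distrib_left distrib_right by (simp; linarith)
  qed
  have g: "0 \<le> ?g x \<and> ?g x \<le> 1" if "real p \<le> x" for x :: real
    using big[OF that] that p by (auto simp: divide_le_eq intro!: divide_nonneg_pos)
  have "continuous_on {real p..real q + 1} ?g"
    using big by (intro continuous_intros) force
  from equation_root[OF _ _ this] g q
  obtain l where l: "real p \<le> l" "l \<le> real q + 1" "l\<^sup>2 = q * (real p + ?g l)" by auto
  have l0: "l > 0" "l\<^sup>2 > m" using l(1) p big[OF l(1)] by auto
  obtain z where z: "embedding_solution p ((\<lambda>i. {0, i}) ` {1..m}) l z" "(\<Sum>v<p. z v) = p + ?g l"
    using star_solution[of m p l] p l0 by auto
  have "2 * real m / l + ((real m)\<^sup>2 + m) / l\<^sup>2 = (2 * real m * l + m + (real m)\<^sup>2) / l\<^sup>2"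
    using l0 by (simp add: field_simps power2_eq_square)
  also have "\<dots> \<le> ?g l" using l0 by (intro divide_left_mono) auto
  finally have "p + 2 * real m / l + ((real m)\<^sup>2 + m) / l\<^sup>2 + (if m = 3 then 24 else 0) / l ^ 3 \<le> (\<Sum>v<p. z v)"
    using False z(2) by simp
  moreover have "simple_graph ({..<p}, (\<lambda>i. {0, i}) ` {1..m})"
    using p by (auto simp: simple_graph_def)
  ultimately show ?thesis using that[of _ l z] z l card_star by simp
qed

subsection \<open>Stability\<close>

lemma four_mult_floor:
  fixes p q :: nat
  assumes "p \<le> q" "q \<le> p + 1"
  shows "(p + q)\<^sup>2 \<le> 4 * (p * q) + 1"
proof -
  have "q = p \<or> q = p + 1" using assms by auto
  thus ?thesis by (auto simp: power2_eq_square algebra_simps)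
qed

lemma mult_le_balanced:
  fixes a b p q :: nat
  assumes "p \<le> q" "q \<le> p + 1" "a + b = p + q"
  shows "a * b \<le> p * q"
  using four_mult_le_square_add[of a b] four_mult_floor[OF assms(1,2)] assms(3) by simp

text \<open>A graph with more edges would exceed \<open>n^2/4\<close>, so
  \<open>packing_free_structure\<close> applies with deficit 0. It leaves at most \<open>m\<close>
  inner edges, and there are at most \<open>p * q\<close> cross edges.\<close>

lemma card_edges_le:
  assumes sg: "simple_graph (V, E)" and V: "card V = p + q" "p \<le> q" "q \<le> p + 1"
    and free: "\<forall>S. packing E S \<longrightarrow> card S \<le> m" and p: "16 * m + 16 \<le> p"
  shows "card E \<le> p * q + m"
proof (rule ccontr)
  assume neg: "\<not> ?thesis"
  note sq = four_mult_floor[OF V(2,3)]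
  have "(card V)\<^sup>2 \<le> 4 * card E + 4 * 0" using neg sq V by simp
  moreover have "8 * (0 + 3 * m) + 8 * m + 8 \<le> card V" using p V by simp
  ultimately have "\<exists>A B. A \<union> B = V \<and> A \<inter> B = {} \<and> card {e\<in>E. e \<subseteq> A \<or> e \<subseteq> B} \<le> m \<and>
      (card V)\<^sup>2 \<le> 4 * card {(u, v)\<in>A \<times> B. {u, v} \<in> E} + 4 * (0 + 3 * m)"
    by (rule packing_free_structure[OF sg free])
  then obtain A B where AB: "A \<union> B = V" "A \<inter> B = {}" "card {e\<in>E. e \<subseteq> A \<or> e \<subseteq> B} \<le> m"
    by blast
  have fin: "finite A" "finite B" using simple_graphD(1)[OF sg] unfolding AB(1)[symmetric] by simp_all
  have "card {(u, v)\<in>A \<times> B. {u, v} \<in> E} \<le> card (A \<times> B)" using fin by (intro card_mono) auto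
  moreover have "card A + card B = p + q" using card_Un_disjoint[OF fin AB(2)] AB(1) V by simp
  ultimately show False
    using mult_le_balanced[OF V(2,3), of "card A" "card B"] card_edges_bipartition[OF sg AB(1,2)] AB(3) neg
    by (simp add: card_cartesian_product)
qed

text \<open>The quadratic form of \<open>y\<close> splits into a triangle-free part, controlled by
  \<open>triangle_free_quadratic_form\<close>, and the part of the deleted edges \<open>D\<close>.
  No entry of \<open>y\<close> is large, so the at most \<open>3 * m\<close> edges of
  \<open>D\<close> add at most \<open>54 * m / n\<close> to the bound on \<open>l\<close>. Squaring,
  with \<open>l \<le> n\<close>, costs \<open>108 * m\<close>.\<close>

lemma spectral_edge_bound:
  fixes y :: "'a \<Rightarrow> real" and l :: real and m :: nat
  assumes sg: "simple_graph (V, E)" and free: "\<forall>S. packing E S \<longrightarrow> card S \<le> m"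
    and y: "\<And>v. 0 \<le> y v" "\<exists>v\<in>V. y v \<noteq> 0"
    and sub: "\<And>u. u \<in> V \<Longrightarrow> l * y u \<le> (\<Sum>v\<in>V. adj E u v * y v)"
    and l: "0 < l" "card V \<le> 3 * l" "l \<le> card V" "54 * real m \<le> l"
  shows "l\<^sup>2 - 108 * real m \<le> card E"
proof -
  note S = simple_graphD[OF sg]
  define n where "n = real (card V)"
  define Z where "Z = (\<Sum>v\<in>V. (y v)\<^sup>2)"
  obtain v0 where v0: "v0 \<in> V" "y v0 \<noteq> 0" using y by blast
  have Z: "Z > 0" unfolding Z_def using v0 S(1) by (intro sum_pos2[of _ v0]) auto
  obtain D where D: "D \<subseteq> E" "card D \<le> 3 * m" "triangle_free (E - D)"
    using triangle_free_deletion[OF sg free] by blast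
  have sg0: "simple_graph (V, E - D)" and sgD: "simple_graph (V, D)"
    using sg D(1) by (auto simp: simple_graph_def)
  have adjE: "adj E u v = adj (E - D) u v + adj D u v" for u v using D(1) by (auto simp: adj_def)
  \<comment> \<open>\<open>l * y u\<close> is at most the sum of all entries, which Cauchy-Schwarz
    compares with the norm.\<close>
  have entry: "l\<^sup>2 * (y u)\<^sup>2 \<le> n * Z" if u: "u \<in> V" for u
  proof -
    have "l * y u \<le> (\<Sum>v\<in>V. 1 * y v)"
      using y by (intro order_trans[OF sub[OF u]] sum_mono mult_right_mono) auto
    hence "(l * y u)\<^sup>2 \<le> (\<Sum>v\<in>V. 1 * y v)\<^sup>2" using y l by (intro power_mono) auto
    also have "\<dots> \<le> (\<Sum>v\<in>V. 1\<^sup>2) * (\<Sum>v\<in>V. (y v)\<^sup>2)" by (rule Cauchy_Schwarz_ineq_sum)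
    finally show ?thesis by (simp add: power_mult_distrib n_def Z_def)
  qed
  define c where "c = n * Z / l\<^sup>2"
  have entry': "(y u)\<^sup>2 \<le> c" if "u \<in> V" for u
    using entry[OF that] l by (simp add: c_def pos_le_divide_eq mult.commute)
  have prod: "y u * y v \<le> c" if "u \<in> V" "v \<in> V" for u v
  proof -
    have "2 * (y u * y v) \<le> (y u)\<^sup>2 + (y v)\<^sup>2" using sum_squares_bound[of "y u" "y v"] by simp
    thus ?thesis using entry'[OF that(1)] entry'[OF that(2)] by linarith
  qed
  have c0: "0 \<le> c" using Z by (simp add: c_def n_def)
  have "(\<Sum>u\<in>V. \<Sum>v\<in>V. adj D u v * y u * y v) \<le> (\<Sum>u\<in>V. \<Sum>v\<in>V. adj D u v * c)"
    using prod by (intro sum_mono) (auto simp: mult.assoc intro!: mult_left_mono)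
  also have "\<dots> = 2 * real (card D) * c" by (simp add: sum_distrib_right[symmetric] handshake[OF sgD])
  also have "\<dots> \<le> 6 * real m * c" using D(2) c0 by (intro mult_right_mono) auto
  finally have dsum: "(\<Sum>u\<in>V. \<Sum>v\<in>V. adj D u v * y u * y v) \<le> 6 * real m * c" .
  have "l * Z = (\<Sum>u\<in>V. y u * (l * y u))"
    by (simp add: Z_def sum_distrib_left power2_eq_square mult_ac)
  also have "\<dots> \<le> (\<Sum>u\<in>V. y u * (\<Sum>v\<in>V. adj E u v * y v))"
    using y by (intro sum_mono mult_left_mono sub) auto
  also have "\<dots> = (\<Sum>u\<in>V. \<Sum>v\<in>V. adj (E - D) u v * y u * y v) + (\<Sum>u\<in>V. \<Sum>v\<in>V. adj D u v * y u * y v)"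
    by (simp add: adjE sum_distrib_left sum.distrib distrib_left distrib_right mult_ac)
  also have "\<dots> \<le> sqrt (card (E - D)) * Z + 6 * real m * c"
    unfolding Z_def using triangle_free_quadratic_form[OF sg0 D(3) y(1)] dsum by (intro add_mono) auto
  also have "6 * real m * c = 6 * real m * n / l\<^sup>2 * Z" by (simp add: c_def)
  finally have "Z * l \<le> Z * (sqrt (card (E - D)) + 6 * real m * n / l\<^sup>2)" by (simp add: algebra_simps)
  hence 1: "l \<le> sqrt (card (E - D)) + 6 * real m * n / l\<^sup>2" using Z by simp
  have n0: "n > 0" using l unfolding n_def by linarith
  \<comment> \<open>Here \<open>n \<le> 3 * l\<close> enters, and \<open>6 * 9 = 54\<close>.\<close>
  have "6 * real m * n / l\<^sup>2 \<le> 54 * real m / n"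
  proof -
    have "n * n \<le> (3 * l) * (3 * l)" using l n0 unfolding n_def by (intro mult_mono) auto
    hence "6 * real m * (n * n) \<le> 6 * real m * ((3 * l) * (3 * l))" by (intro mult_left_mono) auto
    thus ?thesis using l n0 by (simp add: divide_simps power2_eq_square algebra_simps)
  qed
  with 1 have 2: "l - 54 * real m / n \<le> sqrt (card (E - D))" by linarith
  have n1: "n \<ge> 1" using n0 unfolding n_def by simp
  have "54 * real m / n \<le> 54 * real m / 1" using n1 by (intro divide_left_mono) auto
  hence 3: "0 \<le> l - 54 * real m / n" using l by simp
  have "2 * (54 * real m / n) * l \<le> 108 * real m"
  proof -
    have "108 * real m * l \<le> 108 * real m * n" using l unfolding n_def by (intro mult_left_mono) auto
    thus ?thesis using n0 by (simp add: divide_le_eq)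
  qed
  hence "l\<^sup>2 - 108 * real m \<le> l\<^sup>2 - 2 * (54 * real m / n) * l + (54 * real m / n)\<^sup>2" by (simp add: add_increasing2)
  also have "\<dots> = (l - 54 * real m / n)\<^sup>2" by (simp add: power2_eq_square algebra_simps)
  also have "\<dots> \<le> (sqrt (card (E - D)))\<^sup>2" using 2 3 by (rule power_mono)
  also have "\<dots> \<le> card E" using S(2) by (simp add: card_mono)
  finally show ?thesis .
qed

text \<open>\<open>b\<close> is the size of the part opposite to the inner edges. If it were smaller
  than \<open>q\<close>, one copy of \<open>2 * m * l\<close> would be lost, while the walks of
  length three bring back at most \<open>4 * m^3\<close>. Once \<open>b = q\<close>, these walks
  decide between star and triangle for \<open>m = 3\<close>.\<close>

lemma one_sided_conclusion:
  fixes m p q b :: nat and l :: real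
  assumes sg: "simple_graph (A, F)" and F: "card F = m" "1 \<le> m"
    and int: "\<And>e e'. e \<in> F \<Longrightarrow> e' \<in> F \<Longrightarrow> e \<inter> e' \<noteq> {}" and w2: "w2 A F = (real m)\<^sup>2 + m"
    and b: "b = p \<or> b = q" and pq: "p \<le> q" "q \<le> p + 1" and l: "p \<le> l" "l \<le> real q + 1"
    and p: "2 * m ^ 3 + 2 * m + 20 \<le> p"
    and lo: "q * (p + 2 * real m / l + ((real m)\<^sup>2 + m) / l\<^sup>2 + (if m = 3 then 24 else 0) / l ^ 3) \<le> l\<^sup>2"
    and up: "l\<^sup>2 \<le> real p * real q + b * gain A F m l / l"
  shows "b = q" "if m = 3 then \<exists>a b c. a \<noteq> b \<and> b \<noteq> c \<and> a \<noteq> c \<and> F = {{a, b}, {b, c}, {a, c}}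
    else \<exists>c. \<forall>e\<in>F. c \<in> e"
proof -
  define s where "s = w3 A F"
  define t :: real where "t = (if m = 3 then 24 else 0)"
  have rp: "2 * real m ^ 3 + 2 * real m + 20 \<le> l"
  proof -
    have "real (2 * m ^ 3 + 2 * m + 20) \<le> real p" using p by (rule of_nat_mono)
    thus ?thesis using l by simp
  qed
  have m0: "0 \<le> real m ^ 3" by simp
  have l20: "20 \<le> l" using rp m0 of_nat_0_le_iff[of m] by linarith
  have lm: "1 \<le> l" "real m < l" "l \<le> 2 * (l - m)"
  proof -
    have "2 * real m + 20 \<le> l" using rp m0 by linarith
    thus "1 \<le> l" "real m < l" "l \<le> 2 * (l - m)" by auto
  qed
  have s0: "0 \<le> s" using walks_nonneg by (simp add: s_def)
  have "deg A F u * deg A F v \<le> real m * real m" for u v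
    using deg_le_card[OF sg] F(1) by (intro mult_mono) auto
  from w3_le[OF sg this] have s: "s \<le> 2 * real m ^ 3"
    by (simp add: s_def F(1) power3_eq_cube mult_ac)
  have "w1 A F = 2 * real m" using w1_eq[OF sg] F(1) by simp
  hence gain: "gain A F m l = 2 * real m + ((real m)\<^sup>2 + m) / l + s / (l * (l - m))"
    by (simp add: gain_def w2 s_def)
  have bd: "q * (2 * real m * l + ((real m)\<^sup>2 + m) + t / l) \<le> b * (2 * real m * l + ((real m)\<^sup>2 + m) + s / (l - m))"
    using lo up unfolding t_def by (intro one_sided_bound[OF lm(1,2) gain]) simp_all
  define X where "X = 2 * real m * l + ((real m)\<^sup>2 + m)"
  have bd': "q * X + q * (t / l) \<le> b * X + b * (s / (l - m))" using bd by (simp add: X_def distrib_left)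
  have t0: "0 \<le> q * (t / l)" using lm by (simp add: t_def)
  show bq: "b = q"
  proof (rule ccontr)
    assume "b \<noteq> q"
    hence "q = b + 1" "b = p" using b pq by auto
    hence "X \<le> b * (s / (l - m))" using bd' t0 by (simp add: algebra_simps)
    also have "\<dots> \<le> (2 * (l - m)) * (s / (l - m))"
      using \<open>b = p\<close> l lm s0 by (intro mult_right_mono) auto
    also have "\<dots> = 2 * s" using lm(2) by (simp add: field_simps)
    also have "\<dots> \<le> 4 * real m ^ 3" using s by simp
    finally have X4: "X \<le> 4 * real m ^ 3" .
    have "1 * l \<le> real m * l" using F(2) lm by (intro mult_right_mono) auto
    moreover have "0 \<le> (real m)\<^sup>2 + real m" by simp
    ultimately have "2 * l \<le> X" unfolding X_def mult.assoc by linarith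
    with X4 rp show False by linarith
  qed
  have "F \<noteq> {}" using F by auto
  from intersecting_edges_star_or_triangle[OF simple_graphD(4)[OF sg] this int]
  have cases: "(\<exists>c. \<forall>e\<in>F. c \<in> e) \<or>
    (\<exists>a b c. a \<noteq> b \<and> b \<noteq> c \<and> a \<noteq> c \<and> F = {{a, b}, {b, c}, {a, c}})" by blast
  show "if m = 3 then \<exists>a b c. a \<noteq> b \<and> b \<noteq> c \<and> a \<noteq> c \<and> F = {{a, b}, {b, c}, {a, c}}
    else \<exists>c. \<forall>e\<in>F. c \<in> e"
  proof (cases "m = 3")
    case True
    have "\<not> (\<exists>c. \<forall>e\<in>F. c \<in> e)"
    proof
      assume "\<exists>c. \<forall>e\<in>F. c \<in> e"
      then obtain c where "\<And>e. e \<in> F \<Longrightarrow> c \<in> e" by blast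
      \<comment> \<open>A star with three edges has at most \<open>2 * 3 * 3 = 18\<close> walks of
        length three. The resulting inequality \<open>24 * (l - 3) \<le> 18 * l\<close> fails for
        \<open>l > 12\<close>.\<close>
      from w3_le[OF sg star_deg_product[OF sg this]] have "s \<le> 18"
        using F(1) True by (simp add: s_def)
      moreover have "24 * (l - 3) \<le> s * l"
      proof -
        have "20 \<le> p" using p by (rule add_leE)
        hence q0: "real q > 0" using pq(1) by simp
        have l3: "l > 3" using l20 by linarith
        have "real q * (t / l) \<le> real q * (s / (l - m))" using bd'[unfolded bq] by linarith
        hence "real q * (24 / l) \<le> real q * (s / (l - 3))" unfolding t_def True by simp
        from mult_left_le_imp_le[OF this q0] have "24 \<le> s * l / (l - 3)"
          using l3 by (simp add: pos_divide_le_eq)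
        thus ?thesis using l3 by (simp add: pos_le_divide_eq)
      qed
      moreover have "s * l \<le> 18 * l" using \<open>s \<le> 18\<close> lm by (intro mult_right_mono) auto
      ultimately have "24 * (l - 3) \<le> 18 * l" by (meson order_trans)
      hence "6 * l \<le> 72" by simp
      with l20 show False by simp
    qed
    with cases show ?thesis unfolding if_P[OF True] by argo
  next
    case False
    have "\<not> (\<exists>a b c. a \<noteq> b \<and> b \<noteq> c \<and> a \<noteq> c \<and> F = {{a, b}, {b, c}, {a, c}})"
    proof
      assume "\<exists>a b c. a \<noteq> b \<and> b \<noteq> c \<and> a \<noteq> c \<and> F = {{a, b}, {b, c}, {a, c}}"
      then obtain a b c where "a \<noteq> b" "b \<noteq> c" "a \<noteq> c" and Feq: "F = {{a, b}, {b, c}, {a, c}}" by blast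
      hence "{a, b} \<noteq> {b, c}" "{a, b} \<noteq> {a, c}" "{b, c} \<noteq> {a, c}" by (auto simp: doubleton_eq_iff)
      hence "card F = 3" unfolding Feq by simp
      with F(1) False show False by simp
    qed
    with cases show ?thesis unfolding if_not_P[OF False] by argo
  qed
qed

subsection \<open>Extremal graphs\<close>

text \<open>The graph of \<open>bipartite_with_embedded\<close> for fixed parts, with the embedded
  graph reduced to its edge set.\<close>

definition embedded :: "'a set \<Rightarrow> 'a set \<Rightarrow> 'a set set \<Rightarrow> 'a graph" where
  "embedded A B F = (A \<union> B, edges (complete_bipartite A B) \<union> F)"

lemma adj_embedded:
  assumes "simple_graph (A, F)" "A \<inter> B = {}"
  shows "u \<in> A \<Longrightarrow> v \<in> A \<Longrightarrow> adj (edges (embedded A B F)) u v = adj F u v"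
    and "u \<in> A \<Longrightarrow> v \<in> B \<Longrightarrow> adj (edges (embedded A B F)) u v = 1"
    and "u \<in> B \<Longrightarrow> v \<in> A \<Longrightarrow> adj (edges (embedded A B F)) u v = 1"
    and "u \<in> B \<Longrightarrow> v \<in> B \<Longrightarrow> adj (edges (embedded A B F)) u v = 0"
proof -
  have F: "{x, y} \<in> F \<Longrightarrow> x \<in> A \<and> y \<in> A" for x y
    using simple_graphD(5)[OF assms(1)] by blast
  have C: "{x, y} \<in> edges (complete_bipartite A B) \<longleftrightarrow> x \<in> A \<and> y \<in> B \<or> x \<in> B \<and> y \<in> A" for x y
    by (auto simp: complete_bipartite_def doubleton_eq_iff)
  show "u \<in> A \<Longrightarrow> v \<in> A \<Longrightarrow> adj (edges (embedded A B F)) u v = adj F u v"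
    "u \<in> A \<Longrightarrow> v \<in> B \<Longrightarrow> adj (edges (embedded A B F)) u v = 1"
    "u \<in> B \<Longrightarrow> v \<in> A \<Longrightarrow> adj (edges (embedded A B F)) u v = 1"
    "u \<in> B \<Longrightarrow> v \<in> B \<Longrightarrow> adj (edges (embedded A B F)) u v = 0"
    using assms(2) F by (auto simp: adj_def embedded_def C)
qed

lemma simple_graph_embedded:
  assumes F: "simple_graph (A, F)" and B: "finite B" and AB: "A \<inter> B = {}"
  shows "simple_graph (embedded A B F)"
proof -
  have "e \<subseteq> A \<union> B \<and> card e = 2" if e: "e \<in> edges (complete_bipartite A B) \<union> F" for e
  proof (cases "e \<in> F")
    case True
    thus ?thesis using simple_graphD(3,4)[OF F] by blast
  next
    case False
    then obtain a b where "e = {a, b}" "a \<in> A" "b \<in> B"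
      using e by (auto simp: complete_bipartite_def)
    moreover from this have "a \<noteq> b" using AB by blast
    ultimately show ?thesis by simp
  qed
  thus ?thesis using simple_graphD(1)[OF F] B by (simp add: simple_graph_def embedded_def)
qed

text \<open>A complete bipartite graph has no triangle, so each triangle uses an edge of
  \<open>F\<close>; edge-disjoint triangles use different ones.\<close>

lemma packing_embedded_le:
  assumes F: "simple_graph (A, F)" and AB: "A \<inter> B = {}" and S: "packing (edges (embedded A B F)) S"
  shows "card S \<le> card F"
proof -
  have ex: "\<exists>e. e \<in> T \<inter> F" if T: "T \<in> S" for T
  proof -
    obtain a b c where T: "T = {{a, b}, {b, c}, {a, c}}" and sub: "T \<subseteq> edges (embedded A B F)"
      using S T unfolding packing_def triangles_def by auto
    have C: "{x, y} \<in> edges (complete_bipartite A B) \<longleftrightarrow> x \<in> A \<and> y \<in> B \<or> x \<in> B \<and> y \<in> A" for x y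
      by (auto simp: complete_bipartite_def doubleton_eq_iff)
    have "(x \<in> A \<and> y \<in> B \<or> x \<in> B \<and> y \<in> A) \<or> {x, y} \<in> F" if "{x, y} \<in> T" for x y
    proof -
      have "{x, y} \<in> edges (complete_bipartite A B) \<union> F" using that sub by (auto simp: embedded_def)
      thus ?thesis by (simp add: C)
    qed
    from this[of a b] this[of b c] this[of a c]
    have "(a \<in> A \<and> b \<in> B \<or> a \<in> B \<and> b \<in> A) \<or> {a, b} \<in> F"
      "(b \<in> A \<and> c \<in> B \<or> b \<in> B \<and> c \<in> A) \<or> {b, c} \<in> F"
      "(a \<in> A \<and> c \<in> B \<or> a \<in> B \<and> c \<in> A) \<or> {a, c} \<in> F" by (simp_all add: T)
    moreover have "\<not> (x \<in> A \<and> x \<in> B)" for x using AB by blast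
    note this[of a] this[of b] this[of c]
    ultimately have "{a, b} \<in> F \<or> {b, c} \<in> F \<or> {a, c} \<in> F" by argo
    thus ?thesis by (auto simp: T)
  qed
  define f where "f T = (SOME e. e \<in> T \<inter> F)" for T
  have f: "f T \<in> T" "f T \<in> F" if "T \<in> S" for T
    using someI_ex[OF ex[OF that]] by (auto simp: f_def)
  have "inj_on f S"
  proof (rule inj_onI)
    fix T T' assume T: "T \<in> S" "T' \<in> S" "f T = f T'"
    hence "\<not> disjnt T T'" using f(1)[OF T(1)] f(1)[OF T(2)] by (auto simp: disjnt_def)
    thus "T = T'" using S T(1,2) by (auto simp: packing_def pairwise_def)
  qed
  moreover have "f ` S \<subseteq> F" using f by blast
  ultimately show ?thesis using simple_graphD(2)[OF F] by (rule card_inj_on_le)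
qed

text \<open>For a vertex of \<open>A\<close>, the constant value \<open>l / card B\<close> on
  \<open>B\<close> adds up to the inhomogeneous term \<open>l\<close>; for a vertex of
  \<open>B\<close>, the eigenvalue equation is \<open>eq\<close>.\<close>

lemma embedded_eigvec:
  fixes l :: real and z :: "'a \<Rightarrow> real"
  assumes F: "simple_graph (A, F)" and B: "finite B" "B \<noteq> {}" and AB: "A \<inter> B = {}" and l: "l \<noteq> 0"
    and z: "\<And>u. u \<in> A \<Longrightarrow> l * z u = (\<Sum>v\<in>A. adj F u v * z v) + l"
    and eq: "l\<^sup>2 = card B * (\<Sum>v\<in>A. z v)"
  shows "is_eigvec (embedded A B F) l (\<lambda>v. if v \<in> A then z v else l / card B)"
proof -
  define x where "x v = (if v \<in> A then z v else l / card B)" for v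
  have b: "real (card B) > 0" using B by (simp add: card_gt_0_iff)
  have fA: "finite A" by (rule simple_graphD(1)[OF F])
  note ad = adj_embedded[OF F AB]
  have xB: "x v = l / card B" if "v \<in> B" for v using that AB by (auto simp: x_def)
  have sp: "(\<Sum>v\<in>A \<union> B. g v) = (\<Sum>v\<in>A. g v) + (\<Sum>v\<in>B. g v)" for g :: "'a \<Rightarrow> real"
    by (rule sum.union_disjoint[OF fA B(1) AB])
  have "(\<Sum>v\<in>A \<union> B. adj (edges (embedded A B F)) u v * x v) = l * x u" if u: "u \<in> A \<union> B" for u
  proof (cases "u \<in> A")
    case True
    have "(\<Sum>v\<in>A. adj (edges (embedded A B F)) u v * x v) = (\<Sum>v\<in>A. adj F u v * z v)"
      using True by (intro sum.cong refl) (simp add: ad x_def)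
    moreover have "(\<Sum>v\<in>B. adj (edges (embedded A B F)) u v * x v) = (\<Sum>v\<in>B. l / card B)"
      using True by (intro sum.cong refl) (simp add: ad xB)
    ultimately show ?thesis unfolding sp using True z[OF True] b by (simp add: x_def)
  next
    case False
    hence uB: "u \<in> B" using u by blast
    have "(\<Sum>v\<in>A. adj (edges (embedded A B F)) u v * x v) = (\<Sum>v\<in>A. z v)"
      using uB by (intro sum.cong refl) (simp add: ad x_def)
    moreover have "(\<Sum>v\<in>B. adj (edges (embedded A B F)) u v * x v) = 0"
      using uB by (intro sum.neutral ballI) (simp add: ad)
    moreover have "(\<Sum>v\<in>A. z v) = l * (l / card B)"
      using eq b by (simp add: field_simps power2_eq_square)
    ultimately show ?thesis unfolding sp using xB[OF uB] by simp
  qed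
  moreover have "\<exists>v\<in>A \<union> B. x v \<noteq> 0"
    using B(2) xB l b by (metis UnI2 divide_eq_0_iff equals0I less_irrefl)
  ultimately have "is_eigvec (embedded A B F) l x" by (simp add: is_eigvec_def embedded_def)
  thus ?thesis by (simp add: x_def[abs_def])
qed

text \<open>\<open>K\<close> bounds \<open>w\<^sub>2 + w\<^sub>3\<close>, \<open>M\<close> the total gain, and \<open>2 * C\<close> the difference of the part sizes.\<close>

definition threshold :: "nat \<Rightarrow> nat" where
  "threshold m = (let K = m\<^sup>2 + m + 2 * m ^ 3; M = 2 * m + K; C = 111 * m + 1 in
     M + C * M + M\<^sup>2 + 8 * C + 4 * m ^ 3 + 70 * m + 40)"

text \<open>Successive comparisons fix the structure. \<open>first_order_bound\<close> yields
  balanced parts, all cross edges and \<open>m\<close> inner edges;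
  \<open>second_order_bound\<close> makes the inner edges meet pairwise, hence lie in one part;
  \<open>one_sided_conclusion\<close> decides which part and which shape.\<close>

lemma extremal_structure:
  fixes m p q :: nat and l :: real and y :: "'a \<Rightarrow> real"
  assumes m: "1 \<le> m" and sg: "simple_graph (V, E)" and V: "card V = p + q" and pq: "p \<le> q" "q \<le> p + 1"
    and p: "threshold m \<le> p" and free: "\<forall>S. packing E S \<longrightarrow> card S \<le> m"
    and l: "p \<le> l" "l \<le> real q + 1"
    and lo: "q * (p + 2 * real m / l + ((real m)\<^sup>2 + m) / l\<^sup>2 + (if m = 3 then 24 else 0) / l ^ 3) \<le> l\<^sup>2"
    and y: "\<And>v. 0 \<le> y v" "\<exists>v\<in>V. y v \<noteq> 0"
    and sub: "\<And>u. u \<in> V \<Longrightarrow> l * y u \<le> (\<Sum>v\<in>V. adj E u v * y v)"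
  shows "\<exists>A B F. A \<union> B = V \<and> A \<inter> B = {} \<and> card A = p \<and> card B = q \<and>
    E = edges (complete_bipartite A B) \<union> F \<and> simple_graph (A, F) \<and> card F = m \<and>
    (if m = 3 then \<exists>a b c. a \<noteq> b \<and> b \<noteq> c \<and> a \<noteq> c \<and> F = {{a, b}, {b, c}, {a, c}}
     else \<exists>c. \<forall>e\<in>F. c \<in> e)"
proof -
  note SG = simple_graphD[OF sg]
  define K where "K = m\<^sup>2 + m + 2 * m ^ 3"
  define M where "M = 2 * m + K"
  \<comment> \<open>\<open>108 * m\<close> is the loss in \<open>spectral_edge_bound\<close>, 1
    covers the rounding of \<open>n^2/4\<close>, and \<open>3 * m\<close> is lost by deleting a
    packing.\<close>
  define C where "C = 111 * m + 1"
  have thr: "M + C * M + M\<^sup>2 + 8 * C + 4 * m ^ 3 + 70 * m + 40 \<le> p"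
    using p by (simp add: threshold_def Let_def K_def M_def C_def)
  have "real (M + C * M + M\<^sup>2 + 8 * C + 4 * m ^ 3 + 70 * m + 40) \<le> real p"
    using thr by (rule of_nat_mono)
  hence thr_p: "real M + real C * real M + (real M)\<^sup>2 + 8 * real C + 4 * real m ^ 3 + 70 * real m + 40 \<le> real p"
    by simp
  hence thr_l: "real M + real C * real M + (real M)\<^sup>2 + 8 * real C + 4 * real m ^ 3 + 70 * real m + 40 \<le> l"
    using l(1) by simp
  have nn: "0 \<le> real M" "0 \<le> real C * real M" "0 \<le> (real M)\<^sup>2" "0 \<le> real C" "0 \<le> real m ^ 3" "0 \<le> real m"
    by simp_all
  have l0: "l \<ge> 40" and lm: "real m < l" "real m + 1 \<le> l" "2 * real m + 1 \<le> l" "54 * real m \<le> l"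
    using thr_l nn by linarith+
  have p40: "40 \<le> p" and p16: "16 * m + 16 \<le> p" and p3: "2 * m ^ 3 + 2 * m + 20 \<le> p"
    using thr by linarith+
  have gain0: "0 \<le> 2 * real m / l" "0 \<le> ((real m)\<^sup>2 + m) / l\<^sup>2" "0 \<le> (if m = 3 then 24 else 0) / l ^ 3"
    using l0 by simp_all
  have lo1: "q * (p + 2 * real m / l) \<le> l\<^sup>2"
    using gain0 by (intro order_trans[OF mult_left_mono lo]) simp_all
  have lo2: "q * (p + 2 * real m / l + ((real m)\<^sup>2 + m) / l\<^sup>2) \<le> l\<^sup>2"
    using gain0 by (intro order_trans[OF mult_left_mono lo]) simp_all
  have lo0: "real q * real p \<le> l\<^sup>2"
    using gain0 by (intro order_trans[OF mult_left_mono lo]) simp_all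
  have "l\<^sup>2 - 108 * real m \<le> card E"
  proof (rule spectral_edge_bound[OF sg free y])
    show "l * y u \<le> (\<Sum>v\<in>V. adj E u v * y v)" if "u \<in> V" for u by (rule sub[OF that])
    show "real (card V) \<le> 3 * l" using V pq l p40 by simp
    show "l \<le> real (card V)" using V pq l p40 by simp
  qed (use l0 lm in auto)
  hence "real (p * q) \<le> real (card E + 108 * m)" using lo0 by (simp add: mult.commute)
  hence "p * q \<le> card E + 108 * m" by (simp only: of_nat_le_iff)
  hence e1: "(card V)\<^sup>2 \<le> 4 * card E + 4 * (108 * m + 1)" using four_mult_floor[OF pq] V by simp
  have "8 * (108 * m + 1 + 3 * m) + 8 * m + 8 \<le> card V" using thr V by (simp add: C_def)
  from packing_free_structure[OF sg free e1 this]
  obtain A B where AB: "A \<union> B = V" "A \<inter> B = {}" and Fm: "card {e\<in>E. e \<subseteq> A \<or> e \<subseteq> B} \<le> m"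
    and X4: "(card V)\<^sup>2 \<le> 4 * card {(u, v)\<in>A \<times> B. {u, v} \<in> E} + 4 * (108 * m + 1 + 3 * m)" by blast
  define F where "F = {e\<in>E. e \<subseteq> A \<or> e \<subseteq> B}"
  define X where "X = {(u, v)\<in>A \<times> B. {u, v} \<in> E}"
  have fin: "finite A" "finite B" using SG(1) unfolding AB(1)[symmetric] by simp_all
  have n: "card A + card B = p + q" using card_Un_disjoint[OF fin AB(2)] AB(1) V by simp
  have F: "card F \<le> m" using Fm by (simp add: F_def)
  have sgF: "simple_graph (V, F)" using sg by (auto simp: simple_graph_def F_def)
  have inner: "\<forall>e\<in>F. e \<subseteq> A \<or> e \<subseteq> B" by (simp add: F_def)
  hence inner': "\<forall>e\<in>F. e \<subseteq> B \<or> e \<subseteq> A" by blast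
  have BA: "B \<union> A = V" "B \<inter> A = {}" using AB by (simp_all add: Un_commute Int_commute)
  have Xs: "X \<subseteq> A \<times> B" by (auto simp: X_def)
  have Xle: "card X \<le> card A * card B"
    using card_mono[OF _ Xs] fin by (simp add: card_cartesian_product)
  have abpq: "card A * card B \<le> p * q" by (rule mult_le_balanced[OF pq n])
  have "(card A + card B)\<^sup>2 \<le> 4 * (card A * card B) + 4 * C"
    using X4[folded X_def] Xle V n by (simp add: C_def)
  hence "card A \<le> card B + 2 * C" "card B \<le> card A + 2 * C"
    using near_balanced[of "card A" "card B" C] near_balanced[of "card B" "card A" C]
    by (simp_all add: mult.commute add.commute)
  \<comment> \<open>As \<open>p + q \<le> 2 * p + 1\<close>, half of the difference bound suffices
    after rounding.\<close>
  hence "card A \<le> p + C" "card B \<le> p + C" using n pq by linarith+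
  hence "real (card A) \<le> real (p + C)" "real (card B) \<le> real (p + C)" by (simp_all only: of_nat_le_iff)
  hence ab: "real (card A) \<le> l + real C" "real (card B) \<le> l + real C" using l by simp_all
  define RA where "RA = gain A F m l"
  define RB where "RB = gain B F m l"
  have R0: "0 \<le> RA" "0 \<le> RB" using gain_nonneg[of "real m" l] lm by (simp_all add: RA_def RB_def)
  have split: "adj E u v = adj F u v" if "u \<in> P" "v \<in> P" "P = A \<or> P = B" for u v P
    using that by (auto simp: adj_def F_def)
  have un: "sum g V = sum g A + sum g B" for g :: "'a \<Rightarrow> real"
    using sum.union_disjoint[OF fin AB(2), of g] AB(1) by simp
  have "l\<^sup>2 \<le> (\<Sum>u\<in>A. \<Sum>v\<in>B. adj E u v) + (card A * RB + card B * RA) / l + RA * RB / l\<^sup>2"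
    unfolding RA_def RB_def
  proof (rule two_sided_walk_bound[OF fin y(1) _ lm(1)])
    fix u assume u: "u \<in> A"
    have "(\<Sum>v\<in>A. adj E u v * y v) = (\<Sum>v\<in>A. adj F u v * y v)"
      by (intro sum.cong refl) (simp add: split[of u A] u)
    moreover have "u \<in> V" using u AB(1) by blast
    ultimately show "l * y u \<le> (\<Sum>v\<in>B. adj E u v * y v) + (\<Sum>w\<in>A. adj F u w * y w)"
      using sub[of u] by (simp add: un)
    show "deg A F u \<le> m"
      using deg_part[OF sgF AB inner u] deg_le_card[OF sgF, of u] F by simp
  next
    fix u assume u: "u \<in> B"
    have "(\<Sum>v\<in>B. adj E u v * y v) = (\<Sum>v\<in>B. adj F u v * y v)"
      by (intro sum.cong refl) (simp add: split[of u B] u)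
    moreover have "u \<in> V" using u AB(1) by blast
    ultimately show "l * y u \<le> (\<Sum>v\<in>A. adj E u v * y v) + (\<Sum>w\<in>B. adj F u w * y w)"
      using sub[of u] by (simp add: un)
    show "deg B F u \<le> m"
      using deg_part[OF sgF BA inner' u] deg_le_card[OF sgF, of u] F by simp
  qed (use y(2) AB(1) in auto)
  moreover have "(\<Sum>u\<in>A. \<Sum>v\<in>B. adj E u v) = card X"
  proof -
    have "X = Sigma A (\<lambda>u. {v\<in>B. {u, v} \<in> E})" by (auto simp: X_def)
    thus ?thesis using fin by (simp add: sum_adj card_SigmaI)
  qed
  ultimately have up: "l\<^sup>2 \<le> card X + (card A * RB + card B * RA) / l + RA * RB / l\<^sup>2" by simp
  note ws = w_split[OF sgF AB inner]
  define s where "s = w3 V F"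
  have Rsum: "RA + RB = 2 * real (card F) + w2 V F / l + s / (l * (l - m))"
    unfolding w1_eq[OF sgF, symmetric] s_def ws[symmetric]
    by (simp add: RA_def RB_def gain_def add_divide_distrib)
  have degm: "deg V F u \<le> m" for u using deg_le_card[OF sgF, of u] F by simp
  have "deg V F u * deg V F v \<le> real m * real m" for u v
    using degm by (intro mult_mono) auto
  from w3_le[OF sgF this] have "s \<le> 2 * real (card F) * (real m * real m)" by (simp add: s_def)
  also have "\<dots> \<le> 2 * real m * (real m * real m)" using F by (intro mult_right_mono) auto
  finally have s: "s \<le> 2 * real m ^ 3" by (simp add: power3_eq_cube mult_ac)
  have s0: "0 \<le> s" using walks_nonneg by (simp add: s_def)
  have "card F * card F + card F \<le> m * m + m" using F by (intro add_mono mult_mono) auto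
  hence "w2 V F \<le> real (m * m + m)" using w2_le(1)[OF sgF] by (meson of_nat_le_iff order_trans)
  hence w2: "w2 V F \<le> (real m)\<^sup>2 + m" by (simp add: power2_eq_square)
  have "s / (l * (l - m)) \<le> s / (l * 1)" using s0 l0 lm by (intro divide_left_mono mult_left_mono) auto
  moreover have "(w2 V F + s) / l \<le> real K / l"
    using w2 s l0 by (intro divide_right_mono) (auto simp: K_def)
  ultimately have RK: "RA + RB \<le> 2 * real (card F) + real K / l"
    using Rsum by (simp add: add_divide_distrib)
  have "real p * real q + 2 * real m \<le> card X + 2 * real (card F) +
      (2 * real m + real K + real C * (2 * real m + real K) + (2 * real m + real K)\<^sup>2) / l"
    by (rule first_order_bound[OF _ l(2) _ _ _ R0 ab RK _ lo1 up]) (use l0 F in auto)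
  moreover have "(2 * real m + real K + real C * (2 * real m + real K) + (2 * real m + real K)\<^sup>2) / l < 1"
  proof -
    have "real M + real C * real M + (real M)\<^sup>2 < l" using thr_l nn by linarith
    thus ?thesis using l0 by (simp add: M_def divide_less_eq)
  qed
  \<comment> \<open>The error is below one and all counts are integers, so equality holds in
    \<open>card X \<le> card A * card B \<le> p * q\<close> and in
    \<open>card F \<le> m\<close>.\<close>
  ultimately have "real (p * q + 2 * m) < real (card X + 2 * card F + 1)" by simp
  hence "p * q + 2 * m \<le> card X + 2 * card F" by (simp only: of_nat_less_iff)
  hence eqs: "card X = card A * card B" "card A * card B = p * q" "card F = m"
    using Xle abpq F by linarith+
  \<comment> \<open>Sum and product determine the pair: \<open>card A\<close> is a root of
    \<open>(x - p) * (x - q)\<close>.\<close>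
  have parts: "card A = p \<and> card B = q \<or> card A = q \<and> card B = p"
  proof -
    have s1: "int (card A) + int (card B) = int p + int q" using n by linarith
    have "int (card A * card B) = int (p * q)" using eqs(2) by (rule arg_cong)
    hence s2: "int (card A) * int (card B) = int p * int q" by simp
    have "(int (card A) - p) * (int (card A) - q) =
        int (card A) * int (card A) - int (card A) * (int p + int q) + int p * int q"
      by (simp add: algebra_simps)
    also have "\<dots> = 0" unfolding s1[symmetric] s2[symmetric] by (simp add: algebra_simps)
    finally have "card A = p \<or> card A = q" by simp
    thus ?thesis using n by auto
  qed
  have pqle: "card A \<le> q" "card B \<le> q" "real q \<le> l + 1" using parts pq l by auto
  have up2: "l\<^sup>2 \<le> real p * real q + (card A * RB + card B * RA) / l + RA * RB / l\<^sup>2"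
  proof -
    have "card X = p * q" using eqs by simp
    thus ?thesis using up by simp
  qed
  have RM: "RA + RB \<le> real M"
  proof -
    have "real K / l \<le> real K" using l0 by (simp add: divide_le_eq mult_le_cancel_left1)
    thus ?thesis using RK eqs(3) by (simp add: M_def)
  qed
  have "real q * ((real m)\<^sup>2 + m) \<le> real q * w2 V F + (2 * s + (real M)\<^sup>2)"
    using Rsum eqs(3) l0 lm pqle R0 s0 RM lo2 up2
    by (intro second_order_bound[of l "real m" "real q" RA RB s "real (card A)" "real (card B)" _ _ "real p"]) auto
  moreover have "2 * s + (real M)\<^sup>2 < real q"
  proof -
    have "real p \<le> real q" using pq by simp
    thus ?thesis using thr_p nn s by linarith
  qed
  \<comment> \<open>The error is below \<open>q\<close>, so \<open>w2\<close> falls short of its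
    maximum by less than one; being an integer, it is maximal.\<close>
  ultimately have "real q * ((real m)\<^sup>2 + m) < real q * (w2 V F + 1)" by (simp add: distrib_left)
  hence w2lt: "(real m)\<^sup>2 + m < w2 V F + 1" by (simp add: mult_less_cancel_left)
  have w2eq: "w2 V F = (real m)\<^sup>2 + m"
  proof -
    have "real (m\<^sup>2 + m) < real (\<Sum>e\<in>F. \<Sum>e'\<in>F. card (e \<inter> e')) + 1"
      using w2lt[unfolded sum_degree_squares[OF sgF]] by simp
    hence "m\<^sup>2 + m \<le> (\<Sum>e\<in>F. \<Sum>e'\<in>F. card (e \<inter> e'))" by linarith
    hence "real (m\<^sup>2 + m) \<le> w2 V F" unfolding sum_degree_squares[OF sgF] by (rule of_nat_mono)
    thus ?thesis using w2 by simp
  qed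
  have int: "e \<inter> e' \<noteq> {}" if "e \<in> F" "e' \<in> F" for e e'
    using w2_le(2)[OF sgF that] w2eq eqs(3) by (auto simp: power2_eq_square)
  have "X = A \<times> B" using Xs eqs(1) fin by (intro card_subset_eq) (simp_all add: card_cartesian_product)
  hence cross: "{u, v} \<in> E" if "u \<in> A" "v \<in> B" for u v using that by (auto simp: X_def)
  have E: "E = edges (complete_bipartite A B) \<union> F"
  proof (intro equalityI subsetI)
    fix e assume e: "e \<in> E"
    hence "card e = 2" "e \<subseteq> V" using SG by auto
    then obtain x z where xz: "e = {x, z}" by (auto simp: card_2_iff)
    show "e \<in> edges (complete_bipartite A B) \<union> F"
    proof (cases "e \<in> F")
      case False
      have "x \<in> A \<union> B" "z \<in> A \<union> B" using xz \<open>e \<subseteq> V\<close> AB(1) by auto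
      hence "x \<in> A \<and> z \<in> B \<or> z \<in> A \<and> x \<in> B" using False e xz by (auto simp: F_def)
      thus ?thesis by (auto simp: xz complete_bipartite_def doubleton_eq_iff)
    qed simp
  qed (auto simp: complete_bipartite_def cross F_def)
  have conclude: "card P' = q \<and> (if m = 3 then \<exists>a b c. a \<noteq> b \<and> b \<noteq> c \<and> a \<noteq> c \<and> F = {{a, b}, {b, c}, {a, c}}
      else \<exists>c. \<forall>e\<in>F. c \<in> e)"
    if sgP: "simple_graph (P, F)" and w: "w2 P F = (real m)\<^sup>2 + m" and P': "card P' = p \<or> card P' = q"
      and u: "l\<^sup>2 \<le> real p * real q + card P' * gain P F m l / l" for P P'
    using one_sided_conclusion[OF sgP eqs(3) m int w P' pq l p3 lo u] by blast
  \<comment> \<open>Pairwise meeting edges cannot be spread over both parts, so the part of one edge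
    \<open>e0\<close> is the part of all.\<close>
  obtain e0 where e0: "e0 \<in> F" using eqs(3) m by fastforce
  consider "e0 \<subseteq> A" | "e0 \<subseteq> B" using inner[rule_format, OF e0] by blast
  thus ?thesis
  proof cases
    case 1
    have sub: "e \<subseteq> A" if "e \<in> F" for e
      using inner[rule_format, OF that] int[OF that e0] 1 AB(2) by blast
    have sgP: "simple_graph (A, F)" using sub sgF fin by (auto simp: simple_graph_def)
    have "adj F u v = 0" if "u \<in> B" for u v using sub that AB(2) by (auto simp: adj_def)
    \<comment> \<open>The gain of a part without inner edges vanishes, which turns
      \<open>up2\<close> into a one-sided estimate.\<close>
    hence z: "w1 B F = 0" "w2 B F = 0" "w3 B F = 0" by (simp_all add: w1_def w2_def w3_def deg_def)
    hence "RB = 0" by (simp add: RB_def gain_def)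
    hence c: "card B = q \<and> (if m = 3 then \<exists>a b c. a \<noteq> b \<and> b \<noteq> c \<and> a \<noteq> c \<and> F = {{a, b}, {b, c}, {a, c}}
      else \<exists>c. \<forall>e\<in>F. c \<in> e)"
      using ws(2) z w2eq up2 parts by (intro conclude[OF sgP]) (auto simp: RA_def)
    hence "card A = p" using n by simp
    show ?thesis
      by (rule exI[of _ A], rule exI[of _ B], rule exI[of _ F])
        (intro conjI AB E sgP eqs(3) c[THEN conjunct1] c[THEN conjunct2] \<open>card A = p\<close>)
  next
    case 2
    have sub: "e \<subseteq> B" if "e \<in> F" for e
      using inner[rule_format, OF that] int[OF that e0] 2 AB(2) by blast
    have sgP: "simple_graph (B, F)" using sub sgF fin by (auto simp: simple_graph_def)
    have "adj F u v = 0" if "u \<in> A" for u v using sub that AB(2) by (auto simp: adj_def)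
    hence z: "w1 A F = 0" "w2 A F = 0" "w3 A F = 0" by (simp_all add: w1_def w2_def w3_def deg_def)
    hence "RA = 0" by (simp add: RA_def gain_def)
    hence c: "card A = q \<and> (if m = 3 then \<exists>a b c. a \<noteq> b \<and> b \<noteq> c \<and> a \<noteq> c \<and> F = {{a, b}, {b, c}, {a, c}}
      else \<exists>c. \<forall>e\<in>F. c \<in> e)"
      using ws(2) z w2eq up2 parts by (intro conclude[OF sgP]) (auto simp: RB_def)
    hence "card B = p" using n by simp
    have "edges (complete_bipartite A B) = edges (complete_bipartite B A)"
      by (auto simp: complete_bipartite_def insert_commute)
    hence E': "E = edges (complete_bipartite B A) \<union> F" using E by simp
    show ?thesis
      by (rule exI[of _ B], rule exI[of _ A], rule exI[of _ F])
        (intro conjI BA E' sgP eqs(3) c[THEN conjunct1] c[THEN conjunct2] \<open>card B = p\<close>)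
  qed
qed

section \<open>Isomorphism types of the embedded graph and the extremal number\<close>

lemma triangle_iso_C3:
  assumes "a \<noteq> b" "b \<noteq> c" "a \<noteq> c" and F: "F = {{a, b}, {b, c}, {a, c}}"
  shows "graph_iso (\<Union>F, F) C3"
proof -
  have V: "\<Union>F = {a, b, c}" using F by auto
  define f where "f x = (if x = a then 0 else if x = b then 1 else 2 :: nat)" for x
  have fv: "f a = 0" "f b = 1" "f c = 2" using assms by (auto simp: f_def)
  have bij: "bij_betw f {a, b, c} {0, 1, 2}"
    using assms(1-3) fv by (auto simp: bij_betw_def inj_on_def)
  have Fe: "{u, v} \<in> F \<longleftrightarrow> u \<noteq> v" if "u \<in> {a, b, c}" "v \<in> {a, b, c}" for u v
    using that assms(1-3) by (elim insertE emptyE) (simp_all add: F doubleton_eq_iff)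
  have Ce: "{i, j} \<in> edges C3 \<longleftrightarrow> i \<noteq> j" if "i \<in> {0, 1, 2}" "j \<in> {0, 1, 2}" for i j :: nat
    using that by (elim insertE emptyE) (simp_all add: C3_def doubleton_eq_iff)
  have "{u, v} \<in> F \<longleftrightarrow> {f u, f v} \<in> edges C3" if "u \<in> {a, b, c}" "v \<in> {a, b, c}" for u v
    unfolding Fe[OF that] Ce[OF bij_betwE[OF bij, rule_format, OF that(1)] bij_betwE[OF bij, rule_format, OF that(2)]]
    using inj_on_eq_iff[OF bij_betw_imp_inj_on[OF bij] that] by simp
  moreover have "verts C3 = {0, 1, 2}" by (simp add: C3_def)
  ultimately show ?thesis
    unfolding graph_iso_def fst_conv snd_conv V using bij by (intro exI[of _ f]) simp
qed

text \<open>The centre goes to 0 and the leaves go bijectively to \<open>1, ..., m\<close>, the two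
  parts of \<open>K_bip 1 m\<close>.\<close>

lemma star_iso_K_bip:
  assumes sg: "simple_graph (A, F)" and F: "card F = m" "1 \<le> m" and star: "\<forall>e\<in>F. c \<in> e"
  shows "graph_iso (\<Union>F, F) (K_bip 1 m)"
proof -
  note S = simple_graphD[OF sg]
  define L where "L = \<Union>F - {c}"
  obtain e0 where e0: "e0 \<in> F" using F by fastforce
  have V: "\<Union>F = insert c L" using star e0 by (auto simp: L_def)
  have FL: "F = (\<lambda>v. {c, v}) ` L"
  proof (intro equalityI subsetI)
    fix e assume e: "e \<in> F"
    have "card e = 2" using S(4)[OF e] .
    then obtain x y where "e = {x, y}" "x \<noteq> y" by (auto simp: card_2_iff)
    moreover have "c \<in> e" using star e by blast
    ultimately obtain v where "e = {c, v}" "v \<noteq> c" by (auto simp: doubleton_eq_iff)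
    moreover from this have "v \<in> L" using e by (auto simp: L_def)
    ultimately show "e \<in> (\<lambda>v. {c, v}) ` L" by blast
  next
    fix e assume "e \<in> (\<lambda>v. {c, v}) ` L"
    then obtain v where v: "e = {c, v}" "v \<in> L" by blast
    then obtain e' where e': "e' \<in> F" "v \<in> e'" "v \<noteq> c" by (auto simp: L_def)
    have "card e' = 2" using S(4)[OF e'(1)] .
    then obtain x y where "e' = {x, y}" by (auto simp: card_2_iff)
    moreover have "c \<in> e'" using star e'(1) by blast
    ultimately have "e' = {c, v}" using e'(2,3) by auto
    thus "e \<in> F" using e'(1) v(1) by simp
  qed
  have "inj_on (\<lambda>v. {c, v}) L" by (auto simp: inj_on_def doubleton_eq_iff)
  hence cL: "card L = m" using F(1) card_image FL by metis
  hence fL: "finite L" using F(2) by (intro card_ge_0_finite) simp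
  have "card L = card {1..<1 + m}" using cL by simp
  then obtain h where h: "bij_betw h L {1..<1 + m}"
    using finite_same_card_bij[OF fL finite_atLeastLessThan] by blast
  define f where "f v = (if v = c then 0 else h v)" for v
  have cn: "c \<notin> L" by (simp add: L_def)
  have fc: "f c = 0" by (simp add: f_def)
  have fl: "f v = h v" "f v \<in> {1..<1 + m}" if "v \<in> L" for v
    using that cn bij_betwE[OF h] by (auto simp: f_def)
  have "bij_betw f L {1..<1 + m}"
    using h bij_betw_cong[of L f h "{1..<1 + m}", OF fl(1)] by blast
  moreover have "bij_betw f {c} {0}" by (simp add: bij_betw_def fc)
  moreover have "{1..<1 + m} \<inter> {0} = {}" by simp
  ultimately have "bij_betw f (L \<union> {c}) ({1..<1 + m} \<union> {0})" by (rule bij_betw_combine)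
  moreover have "L \<union> {c} = \<Union>F" "{1..<1 + m} \<union> {0} = verts (K_bip 1 m)"
    by (auto simp: V K_bip_def complete_bipartite_def)
  ultimately have bij: "bij_betw f (\<Union>F) (verts (K_bip 1 m))" by simp
  have K: "{i, j} \<in> edges (K_bip 1 m) \<longleftrightarrow> i = 0 \<and> j \<in> {1..<1 + m} \<or> j = 0 \<and> i \<in> {1..<1 + m}" for i j
    by (auto simp: K_bip_def complete_bipartite_def doubleton_eq_iff)
  have Fe: "{u, v} \<in> F \<longleftrightarrow> u = c \<and> v \<in> L \<or> v = c \<and> u \<in> L" for u v
    by (auto simp: FL doubleton_eq_iff)
  have "{u, v} \<in> F \<longleftrightarrow> {f u, f v} \<in> edges (K_bip 1 m)" if "u \<in> \<Union>F" "v \<in> \<Union>F" for u v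
  proof -
    have f0: "f x = 0 \<longleftrightarrow> x = c" and f1: "f x \<in> {1..<1 + m} \<longleftrightarrow> x \<in> L" if "x \<in> \<Union>F" for x
      using that fl(2)[of x] fc cn unfolding V by auto
    show ?thesis unfolding Fe K f0[OF that(1)] f0[OF that(2)] f1[OF that(1)] f1[OF that(2)] by blast
  qed
  thus ?thesis using bij unfolding graph_iso_def by auto
qed

text \<open>\<open>free_graphs n F\<close> may be infinite; the bound \<open>c\<close> makes the set
  of edge numbers finite, so that \<open>Max\<close> is a true maximum.\<close>

lemma ex_number_eqI:
  assumes G: "G \<in> free_graphs n F" and c: "card (edges G) = c"
    and max: "\<And>G'. G' \<in> free_graphs n F \<Longrightarrow> card (edges G') \<le> c"
  shows "G \<in> EX_graphs n F"
proof -
  have "(\<lambda>G. card (edges G)) ` free_graphs n F \<subseteq> {..c}" using max by auto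
  hence "finite ((\<lambda>G. card (edges G)) ` free_graphs n F)" using finite_subset by blast
  hence "ex_number n F = c"
    unfolding ex_number_def using G c max by (intro Max_eqI) auto
  thus ?thesis using G c by (simp add: EX_graphs_def)
qed

section \<open>Comparison of a spectral maximiser with the candidate graph\<close>

theorem theorem5:
  fixes k :: nat
  assumes "k \<ge> 2"
  shows "\<exists>N::nat. \<forall>n\<ge>N. \<forall>G::nat graph.
    G \<in> free_graphs n (Gamma k) \<longrightarrow>
    (\<forall>G'::nat graph. G' \<in> free_graphs n (Gamma k) \<longrightarrow> graph_spectral_radius G' \<le> graph_spectral_radius G) \<longrightarrow>
    G \<in> EX_graphs n (Gamma k) \<and>
    (\<exists>H::nat graph. simple_graph H \<and> card (edges H) = k - 1 \<and>
       (if k = 4 then graph_iso H C3 else graph_iso H (K_bip 1 (k - 1))) \<and>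
       bipartite_with_embedded (nat \<lfloor>real n / 2\<rfloor>) (nat \<lceil>real n / 2\<rceil>) H G)"
proof -
  define m where "m = k - 1"
  have m: "1 \<le> m" and km: "card S < k \<longleftrightarrow> card S \<le> m" for S :: "nat set set set"
    using assms by (auto simp: m_def)
  show ?thesis
  \<comment> \<open>Half of \<open>n\<close>, rounded down, has to reach \<open>threshold m\<close>,
    whence the factor 2.\<close>
  proof (rule exI[of _ "2 * threshold m"], intro allI impI)
    fix n :: nat and G :: "nat graph"
    assume n: "2 * threshold m \<le> n" and G: "G \<in> free_graphs n (Gamma k)"
      and opt: "\<forall>G'::nat graph. G' \<in> free_graphs n (Gamma k) \<longrightarrow>
        graph_spectral_radius G' \<le> graph_spectral_radius G"
    define p where "p = n div 2"
    define q where "q = n - n div 2"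
    have pq: "p \<le> q" "q \<le> p + 1" "p + q = n" by (auto simp: p_def q_def)
    have thr: "threshold m \<le> p" using n by (simp add: p_def)
    have p: "16 * m + 16 \<le> p" using thr by (simp add: threshold_def Let_def)
    have free_iff: "G' \<in> free_graphs n (Gamma k) \<longleftrightarrow> simple_graph G' \<and> card (verts G') = p + q \<and>
        (\<forall>S. packing (edges G') S \<longrightarrow> card S \<le> m)" for G' :: "nat graph"
      unfolding free_graphs_Gamma_iff km pq(3) ..
    obtain V E where GE: "G = (V, E)" by (cases G)
    have sg: "simple_graph (V, E)" and V: "card V = p + q" and free: "\<forall>S. packing E S \<longrightarrow> card S \<le> m"
      using G unfolding free_iff GE by simp_all

    have p8: "3 * m + 8 \<le> p" using p by simp
    obtain F0 :: "nat set set" and l :: real and z :: "nat \<Rightarrow> real" where F0: "simple_graph ({..<p}, F0)" "card F0 = m"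
        "embedding_solution p F0 l z" "l\<^sup>2 = q * (\<Sum>v<p. z v)" and l: "real p \<le> l" "l \<le> real q + 1"
      and lz: "p + 2 * real m / l + ((real m)\<^sup>2 + m) / l\<^sup>2 + (if m = 3 then 24 else 0) / l ^ 3 \<le> (\<Sum>v<p. z v)"
      by (rule optimal_embedding[OF m p8 pq(1)]) (rule that)
    have l0: "l > 0" using l p by simp
    define B0 where "B0 = {p..<p + q}"
    have B0: "finite B0" "B0 \<noteq> {}" "card B0 = q" "{..<p} \<inter> B0 = {}" using p pq by (auto simp: B0_def)
    \<comment> \<open>The candidate graph has no packing of more than \<open>m\<close> triangles, so
      optimality of \<open>G\<close> makes its eigenvalue \<open>l\<close> a lower bound for the
      spectral radius of \<open>G\<close>.\<close>
    define G0 where "G0 = embedded {..<p} B0 F0"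
    have "verts G0 = {..<p + q}" by (auto simp: G0_def embedded_def B0_def)
    hence "G0 \<in> free_graphs n (Gamma k)"
      unfolding free_iff using simple_graph_embedded[OF F0(1) B0(1,4)] packing_embedded_le[OF F0(1) B0(4)] F0(2)
      by (simp add: G0_def)
    hence "graph_spectral_radius G0 \<le> graph_spectral_radius G" using opt by blast
    moreover have "is_eigvec G0 l (\<lambda>v. if v \<in> {..<p} then z v else l / card B0)"
      unfolding G0_def
      using F0(3,4) l0 B0(3)
      by (intro embedded_eigvec[OF F0(1) B0(1,2,4)]) (auto simp: embedding_solution_def)
    hence "l \<le> graph_spectral_radius G0"
      by (intro spectral_radius_ge) (simp_all add: \<open>verts G0 = {..<p + q}\<close>)
    ultimately have lG: "l \<le> graph_spectral_radius G" by linarith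
    have lo: "q * (p + 2 * real m / l + ((real m)\<^sup>2 + m) / l\<^sup>2 + (if m = 3 then 24 else 0) / l ^ 3) \<le> l\<^sup>2"
      by (rule order_trans[OF mult_left_mono[OF lz] eq_refl[OF F0(4)[symmetric]]]) simp

    have "finite (verts G)" "verts G \<noteq> {}"
      using simple_graphD(1)[OF sg] V p by (auto simp: GE)
    note subinvariant = spectral_radius_subinvariant[OF this less_imp_le[OF l0] lG, unfolded GE fst_conv snd_conv]
    obtain y where y: "\<And>v. 0 \<le> y v" "\<exists>v\<in>V. y v \<noteq> 0"
        "\<And>u. u \<in> V \<Longrightarrow> l * y u \<le> (\<Sum>v\<in>V. adj E u v * y v)"
      by (rule subinvariant) (rule that)
    have "\<exists>A B F. A \<union> B = V \<and> A \<inter> B = {} \<and> card A = p \<and> card B = q \<and>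
        E = edges (complete_bipartite A B) \<union> F \<and> simple_graph (A, F) \<and> card F = m \<and>
        (if m = 3 then \<exists>a b c. a \<noteq> b \<and> b \<noteq> c \<and> a \<noteq> c \<and> F = {{a, b}, {b, c}, {a, c}}
         else \<exists>c. \<forall>e\<in>F. c \<in> e)"
      by (rule extremal_structure[OF m sg V pq(1,2) thr free l lo y(1,2)]) (rule y(3))
    then obtain A B F where AB: "A \<union> B = V" "A \<inter> B = {}" "card A = p" "card B = q"
        and E: "E = edges (complete_bipartite A B) \<union> F" and F: "simple_graph (A, F)" "card F = m"
        and shape: "if m = 3 then \<exists>a b c. a \<noteq> b \<and> b \<noteq> c \<and> a \<noteq> c \<and> F = {{a, b}, {b, c}, {a, c}}
          else \<exists>c. \<forall>e\<in>F. c \<in> e" by metis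
    have fin: "finite A" "finite B" using simple_graphD(1)[OF sg] unfolding AB(1)[symmetric] by simp_all

    have "card {(u, v)\<in>A \<times> B. {u, v} \<in> E} = p * q"
    proof -
      have "{(u, v)\<in>A \<times> B. {u, v} \<in> E} = A \<times> B" by (auto simp: E complete_bipartite_def)
      thus ?thesis using AB by (simp add: card_cartesian_product)
    qed
    moreover have "{e\<in>E. e \<subseteq> A \<or> e \<subseteq> B} = F"
    proof -
      have "\<not> (e \<subseteq> A \<or> e \<subseteq> B)" if e: "e \<in> edges (complete_bipartite A B)" for e
      proof -
        obtain a b where "e = {a, b}" "a \<in> A" "b \<in> B" using e by (auto simp: complete_bipartite_def)
        thus ?thesis using AB(2) by blast
      qed
      moreover have "e \<subseteq> A" if "e \<in> F" for e using simple_graphD(3)[OF F(1) that] .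
      ultimately show ?thesis by (auto simp: E)
    qed
    \<comment> \<open>This meets the upper bound of \<open>card_edges_le\<close> with
      equality.\<close>
    ultimately have "card E = p * q + m"
      using card_edges_bipartition[OF sg AB(1,2)] F(2) by simp
    moreover have "card (edges G') \<le> p * q + m" if "G' \<in> free_graphs n (Gamma k)" for G' :: "nat graph"
      using that card_edges_le[of "verts G'" "edges G'", OF _ _ pq(1,2) _ p] unfolding free_iff by simp
    ultimately have "G \<in> EX_graphs n (Gamma k)"
      by (intro ex_number_eqI[OF G]) (simp_all add: GE)
    moreover have "\<exists>H::nat graph. simple_graph H \<and> card (edges H) = k - 1 \<and>
       (if k = 4 then graph_iso H C3 else graph_iso H (K_bip 1 (k - 1))) \<and>
       bipartite_with_embedded (nat \<lfloor>real n / 2\<rfloor>) (nat \<lceil>real n / 2\<rceil>) H G"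
    \<comment> \<open>The vertices of \<open>H\<close> are just the ends of its edges, since
      isolated vertices would spoil the isomorphism.\<close>
    proof (rule exI[of _ "(\<Union>F, F)"], intro conjI)
      have sub: "\<Union>F \<subseteq> A" using simple_graphD(3)[OF F(1)] by blast
      show "simple_graph (\<Union>F, F)"
        using finite_subset[OF sub fin(1)] simple_graphD(4)[OF F(1)] by (auto simp: simple_graph_def)
      show "card (edges (\<Union>F, F)) = k - 1" using F(2) by (simp add: m_def)
      show "if k = 4 then graph_iso (\<Union>F, F) C3 else graph_iso (\<Union>F, F) (K_bip 1 (k - 1))"
      proof (cases "m = 3")
        case True
        then obtain a b c where "a \<noteq> b" "b \<noteq> c" "a \<noteq> c" "F = {{a, b}, {b, c}, {a, c}}"
          using shape by auto
        hence "graph_iso (\<Union>F, F) C3" by (rule triangle_iso_C3)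
        moreover have "k = 4" using True by (simp add: m_def)
        ultimately show ?thesis by simp
      next
        case False
        then obtain c where "\<forall>e\<in>F. c \<in> e" using shape by auto
        from star_iso_K_bip[OF F m this] have "graph_iso (\<Union>F, F) (K_bip 1 (k - 1))"
          by (simp add: m_def)
        moreover have "k \<noteq> 4" using False by (auto simp: m_def)
        ultimately show ?thesis by simp
      qed
      have "nat \<lfloor>real n / 2\<rfloor> = p" unfolding p_def by linarith
      moreover have "nat \<lceil>real n / 2\<rceil> = q" unfolding q_def by linarith
      ultimately show "bipartite_with_embedded (nat \<lfloor>real n / 2\<rfloor>) (nat \<lceil>real n / 2\<rceil>) (\<Union>F, F) G"
        unfolding bipartite_with_embedded_def GE
        using fin AB sub E by (intro exI[of _ A] exI[of _ B]) simp
    qed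
    ultimately show "G \<in> EX_graphs n (Gamma k) \<and>
      (\<exists>H::nat graph. simple_graph H \<and> card (edges H) = k - 1 \<and>
       (if k = 4 then graph_iso H C3 else graph_iso H (K_bip 1 (k - 1))) \<and>
       bipartite_with_embedded (nat \<lfloor>real n / 2\<rfloor>) (nat \<lceil>real n / 2\<rceil>) H G)" by (rule conjI)
  qed
qed

end
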